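(* Let $f:\mathbb{R}\to\mathbb{C}$ be a non-constant periodic Borel function. Then $f$ is not $\mathcal{L}_p$-operator Lipschitz for any $p\in(0,1)$. That is, for every $p\in(0,1)$ there is no constant $C>0$ such that $\|f(A)-f(B)\|_p\leq C\|A-B\|_p$ for all bounded self-adjoint operators $A,B$ on $H$ with $A-B\in\mathcal{L}_p$.
   Context: $H$ is a complex separable infinite-dimensional Hilbert space. For $0<p<\infty$, the Schatten ideal $\mathcal{L}_p$ is the set of compact operators $T$ on $H$ with $\|T\|_p:=\mathrm{Tr}(|T|^p)^{1/p}=\left(\sum_{j\geq 0}\mu(j,T)^p\right)^{1/p}<\infty$, where $\mu(j,T)$ are the singular values of $T$ in non-increasing order (for $p<1$ this is only a quasi-norm); $\|T\|_p=\infty$ if $T\notin\mathcal{L}_p$. $f(A)$ is defined by the Borel functional calculus. A function $f$ is $\mathcal{L}_p$-operator Lipschitz if there is a constant $C_{f,p}>0$ such that $\|f(A)-f(B)\|_p\leq C_{f,p}\|A-B\|_p$ for all bounded self-adjoint $A,B$ on $H$ with $A-B\in\mathcal{L}_p$. *)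

theory Defs
  imports "HOL-Analysis.Analysis"
begin

text \<open>The inner product is antilinear in the first and linear in the second argument.\<close>

class complex_hilbert = banach +
  fixes scaleC :: "complex \<Rightarrow> 'a \<Rightarrow> 'a"
    and cinner :: "'a \<Rightarrow> 'a \<Rightarrow> complex"
  assumes scaleC_add_right: "scaleC c (x + y) = scaleC c x + scaleC c y"
    and scaleC_add_left: "scaleC (c + d) x = scaleC c x + scaleC d x"
    and scaleC_scaleC: "scaleC c (scaleC d x) = scaleC (c * d) x"
    and scaleC_one: "scaleC 1 x = x"
    and scaleR_scaleC: "scaleR r x = scaleC (complex_of_real r) x"
    and cinner_commute: "cinner x y = cnj (cinner y x)"
    and cinner_add_right: "cinner x (y + z) = cinner x y + cinner x z"
    and cinner_scaleC_right: "cinner x (scaleC c y) = c * cinner x y"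
    and cinner_ge_zero: "0 \<le> Re (cinner x x)"
    and cinner_eq_zero_iff: "cinner x x = 0 \<longleftrightarrow> x = 0"
    and norm_eq_sqrt_cinner: "norm x = sqrt (Re (cinner x x))"

global_interpretation complex_vector:
  vector_space "scaleC :: complex \<Rightarrow> 'a \<Rightarrow> 'a::complex_hilbert"
  by unfold_locales (simp_all add: scaleC_add_right scaleC_add_left scaleC_scaleC scaleC_one)

definition infinite_dimensional :: "'a::complex_hilbert itself \<Rightarrow> bool" where
  "infinite_dimensional _ \<longleftrightarrow> \<not> (\<exists>B :: 'a set. finite B \<and> complex_vector.span B = UNIV)"

section \<open>Bounded operators and Schatten ideals\<close>

definition bounded_clinear :: "('a::complex_hilbert \<Rightarrow> 'a) \<Rightarrow> bool" where
  "bounded_clinear T \<longleftrightarrow> bounded_linear T \<and> (\<forall>c x. T (scaleC c x) = scaleC c (T x))"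

definition bounded_self_adjoint :: "('a::complex_hilbert \<Rightarrow> 'a) \<Rightarrow> bool" where
  "bounded_self_adjoint T \<longleftrightarrow> bounded_clinear T \<and> (\<forall>x y. cinner (T x) y = cinner x (T y))"

definition positive_op :: "('a::complex_hilbert \<Rightarrow> 'a) \<Rightarrow> bool" where
  "positive_op T \<longleftrightarrow> bounded_self_adjoint T \<and> (\<forall>x. 0 \<le> Re (cinner x (T x)))"

definition cadjoint :: "('a::complex_hilbert \<Rightarrow> 'a) \<Rightarrow> 'a \<Rightarrow> 'a" where
  "cadjoint T = (THE S. bounded_clinear S \<and> (\<forall>x y. cinner (S x) y = cinner x (T y)))"

definition abs_op :: "('a::complex_hilbert \<Rightarrow> 'a) \<Rightarrow> 'a \<Rightarrow> 'a" where
  "abs_op T = (THE P. positive_op P \<and> P \<circ> P = cadjoint T \<circ> T)"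

definition compact_op :: "('a::complex_hilbert \<Rightarrow> 'a) \<Rightarrow> bool" where
  "compact_op T \<longleftrightarrow> bounded_clinear T \<and> compact (closure (T ` cball 0 1))"

text \<open>For compact \<open>T\<close>, the sequence \<open>singular_values T\<close> lists the positive eigenvalues of
  \<open>|T|\<close> in non-increasing order, repeated according to their (finite) multiplicity, and is
  continued by \<open>0\<close> if there are only finitely many of them.  The limit condition makes every
  set \<open>{j. s j = t}\<close> with \<open>t > 0\<close> finite.\<close>

definition singular_values :: "('a::complex_hilbert \<Rightarrow> 'a) \<Rightarrow> nat \<Rightarrow> real" where
  "singular_values T = (THE s. antimono s \<and> s \<longlonglongrightarrow> 0 \<and>
     (\<forall>t>0. card {j. s j = t} = complex_vector.dim {x. abs_op T x = scaleR t x}))"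

definition schatten_class :: "real \<Rightarrow> ('a::complex_hilbert \<Rightarrow> 'a) set" where
  "schatten_class p = {T. compact_op T \<and> summable (\<lambda>j. singular_values T j powr p)}"

text \<open>The set \<open>D\<close> is the domain of the operator \<open>T\<close>; an operator that is not defined on the
  whole space does not belong to the Schatten class.\<close>

definition schatten_norm :: "real \<Rightarrow> 'a set \<Rightarrow> ('a::complex_hilbert \<Rightarrow> 'a) \<Rightarrow> ennreal" where
  "schatten_norm p D T =
     (if D = UNIV \<and> T \<in> schatten_class p
      then ennreal ((\<Sum>j. singular_values T j powr p) powr (1 / p)) else \<infinity>)"

section \<open>Borel functional calculus\<close>

text \<open>The convention that \<open>E\<close> vanishes on non-Borel sets makes the spectral measure of an
  operator unique as a HOL function.\<close>

definition projection_valued_measure :: "(real set \<Rightarrow> 'a::complex_hilbert \<Rightarrow> 'a) \<Rightarrow> bool" where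
  "projection_valued_measure E \<longleftrightarrow>
     (\<forall>S\<in>sets borel. bounded_self_adjoint (E S) \<and> E S \<circ> E S = E S) \<and>
     E UNIV = id \<and>
     (\<forall>F :: nat \<Rightarrow> real set. range F \<subseteq> sets borel \<longrightarrow> disjoint_family F \<longrightarrow>
        (\<forall>x. (\<lambda>n. E (F n) x) sums E (\<Union>n. F n) x)) \<and>
     (\<forall>S. S \<notin> sets borel \<longrightarrow> E S = (\<lambda>x. 0))"

definition scalar_measure ::
    "(real set \<Rightarrow> 'a::complex_hilbert \<Rightarrow> 'a) \<Rightarrow> 'a \<Rightarrow> real measure" where
  "scalar_measure E x = measure_of UNIV (sets borel) (\<lambda>S. ennreal (Re (cinner x (E S x))))"

definition spectral_measure ::
    "('a::complex_hilbert \<Rightarrow> 'a) \<Rightarrow> real set \<Rightarrow> 'a \<Rightarrow> 'a" where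
  "spectral_measure A = (THE E. projection_valued_measure E \<and> (\<exists>r. E {- r..r} = id) \<and>
     (\<forall>x. cinner x (A x) = complex_of_real (\<integral>t. t \<partial>scalar_measure E x)))"

text \<open>For an unbounded Borel function \<open>f\<close>, the operator \<open>f(A)\<close> may be unbounded, even for
  bounded \<open>A\<close>.  It is the normal operator with dense domain \<open>borel_calculus_dom f A\<close>.  On this
  domain \<open>f(A)\<close> is determined by its quadratic form (by polarization, the scalars being
  complex); outside of it \<open>borel_calculus f A\<close> has the dummy value \<open>0\<close>.\<close>

definition borel_calculus_dom ::
    "(real \<Rightarrow> complex) \<Rightarrow> ('a::complex_hilbert \<Rightarrow> 'a) \<Rightarrow> 'a set" where
  "borel_calculus_dom f A =
     {x. (\<integral>\<^sup>+t. ennreal ((cmod (f t))\<^sup>2) \<partial>scalar_measure (spectral_measure A) x) < \<infinity>}"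

definition borel_calculus ::
    "(real \<Rightarrow> complex) \<Rightarrow> ('a::complex_hilbert \<Rightarrow> 'a) \<Rightarrow> 'a \<Rightarrow> 'a" where
  "borel_calculus f A = (THE T.
     let D = borel_calculus_dom f A in
       (\<forall>x\<in>D. \<forall>y\<in>D. T (x + y) = T x + T y) \<and>
       (\<forall>c. \<forall>x\<in>D. T (scaleC c x) = scaleC c (T x)) \<and>
       (\<forall>x\<in>D. cinner x (T x) = (\<integral>t. f t \<partial>scalar_measure (spectral_measure A) x)) \<and>
       (\<forall>x. x \<notin> D \<longrightarrow> T x = 0))"

text \<open>The difference \<open>f(A) - f(B)\<close> has the domain \<open>dom f(A) \<inter> dom f(B)\<close>.  Applied to real
  multiples of a rank-one projection, the estimate forces \<open>f\<close> to be Lipschitz, hence bounded on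
  bounded sets and with everywhere defined \<open>f(A)\<close>.  So this notion does not depend on how
  differences that are not everywhere defined are treated.\<close>

definition schatten_operator_lipschitz ::
    "'a::complex_hilbert itself \<Rightarrow> real \<Rightarrow> (real \<Rightarrow> complex) \<Rightarrow> bool" where
  "schatten_operator_lipschitz _ p f \<longleftrightarrow>
     (\<exists>C>0. \<forall>A B :: 'a \<Rightarrow> 'a.
        bounded_self_adjoint A \<longrightarrow> bounded_self_adjoint B \<longrightarrow>
        (\<lambda>x. A x - B x) \<in> schatten_class p \<longrightarrow>
        schatten_norm p (borel_calculus_dom f A \<inter> borel_calculus_dom f B)
            (\<lambda>x. borel_calculus f A x - borel_calculus f B x)
          \<le> ennreal C * schatten_norm p UNIV (\<lambda>x. A x - B x))"

end

theory Submission
  imports Defs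
begin

text \<open>
  Let \<open>T\<close> be the period, and choose \<open>a < b < a + T\<close> with \<open>f a \<noteq> f b\<close>.  The two progressions
  \<open>a + j T\<close> and \<open>b + j T\<close> (\<open>j < n\<close>) interlace, so there are self-adjoint operators \<open>B\<close> and \<open>A\<close> on
  the same \<open>n\<close>-dimensional subspace with these spectra whose difference has rank one.
  The function \<open>f\<close> cannot tell the points of one progression apart: \<open>f(B)\<close> and \<open>f(A)\<close> are the
  scalars \<open>f a\<close> and \<open>f b\<close> on the subspace.  If both operators are continued by the scalar \<open>a\<close> on
  the orthogonal complement, then \<open>f(A) - f(B)\<close> is \<open>f b - f a\<close> times the projection of rank \<open>n\<close>,
  and its \<open>p\<close>-norm is \<open>n\<^sup>1\<^sup>/\<^sup>p \<bar>f b - f a\<bar>\<close>.  But \<open>A - B\<close>, being of rank one, has the same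
  \<open>p\<close>-norm for all \<open>p\<close>, namely at most \<open>n T\<close>.  For \<open>p < 1\<close> a Lipschitz estimate would bound
  \<open>n\<^sup>1\<^sup>/\<^sup>p\<close> by a multiple of \<open>n\<close>, which fails for large \<open>n\<close>.

  The perturbation is constructed in \<open>rank_one_interlacing\<close> from the partial fraction
  decomposition of \<open>\<Prod>(z - b\<^sub>i) / \<Prod>(z - a\<^sub>i)\<close>, whose residues have a constant sign because the
  zeros and poles interlace.

  The operators have finite spectrum, so their spectral measures can be written down; that no
  other projection-valued measure represents the same operator is the content of
  \<open>eigenvector_eq\<close>, which shows that such a measure acts on an eigenvector as it must.  The
  Schatten norms involve only multiples of finite-rank projections, for which the absolute
  value and the singular values are explicit (\<open>schatten_span_proj\<close>).
\<close>

section \<open>Inner product\<close>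

lemma cinner_add_left: "cinner (x + y) (z::'a::complex_hilbert) = cinner x z + cinner y z"
  by (metis cinner_add_right cinner_commute complex_cnj_add)

lemma cinner_scaleC_left: "cinner (scaleC c x) (y::'a::complex_hilbert) = cnj c * cinner x y"
  by (metis cinner_scaleC_right cinner_commute complex_cnj_mult)

lemma cinner_zero_right [simp]: "cinner (x::'a::complex_hilbert) 0 = 0"
  using cinner_add_right[of x 0 0] by simp

lemma cinner_zero_left [simp]: "cinner 0 (x::'a::complex_hilbert) = 0"
  using cinner_add_left[of 0 0 x] by simp

lemma cinner_diff_right: "cinner (x::'a::complex_hilbert) (y - z) = cinner x y - cinner x z"
  using cinner_add_right[of x "y - z" z] by simp

lemma cinner_diff_left: "cinner (y - z) (x::'a::complex_hilbert) = cinner y x - cinner z x"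
  using cinner_add_left[of "y - z" z x] by simp

lemma cinner_sum_right: "cinner (x::'a::complex_hilbert) (sum g I) = (\<Sum>i\<in>I. cinner x (g i))"
  by (induction I rule: infinite_finite_induct) (simp_all add: cinner_add_right)

lemma cinner_sum_left: "cinner (sum g I) (x::'a::complex_hilbert) = (\<Sum>i\<in>I. cinner (g i) x)"
  by (induction I rule: infinite_finite_induct) (simp_all add: cinner_add_left)

lemma cinner_self: "cinner x x = complex_of_real ((norm (x::'a::complex_hilbert))\<^sup>2)"
proof -
  have "Im (cinner x x) = 0"
    using arg_cong[OF cinner_commute[of x x], of Im] by simp
  moreover have "Re (cinner x x) = (norm x)\<^sup>2"
    by (simp add: norm_eq_sqrt_cinner cinner_ge_zero)
  ultimately show ?thesis
    by (simp add: complex_eq_iff)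
qed

lemma norm_scaleC: "norm (scaleC c (x::'a::complex_hilbert)) = cmod c * norm x"
proof -
  have "complex_of_real ((norm (scaleC c x))\<^sup>2) = cinner (scaleC c x) (scaleC c x)"
    by (rule cinner_self[symmetric])
  also have "\<dots> = c * cnj c * cinner x x"
    by (simp add: cinner_scaleC_left cinner_scaleC_right)
  also have "\<dots> = complex_of_real ((cmod c * norm x)\<^sup>2)"
    unfolding cinner_self complex_norm_square[symmetric] by (simp add: power_mult_distrib)
  finally have "(norm (scaleC c x))\<^sup>2 = (cmod c * norm x)\<^sup>2"
    by (simp only: of_real_eq_iff)
  then show ?thesis by simp
qed

text \<open>The Cauchy--Schwarz inequality: the component of \<open>x\<close> orthogonal to \<open>y\<close> has the squared norm
  \<open>\<parallel>x\<parallel>\<^sup>2 - \<bar>\<langle>x, y\<rangle>\<bar>\<^sup>2 / \<parallel>y\<parallel>\<^sup>2\<close>.\<close>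

lemma norm_cinner_le: "cmod (cinner x y) \<le> norm x * norm (y::'a::complex_hilbert)"
proof (cases "y = 0")
  case False
  define c where "c = cinner y x"
  define t where "t = c / complex_of_real ((norm y)\<^sup>2)"
  have xy: "cinner x y = cnj c"
    unfolding c_def by (rule cinner_commute)
  have cc: "complex_of_real ((cmod c)\<^sup>2) = c * cnj c"
    by (rule complex_norm_square)
  have y: "complex_of_real ((norm y)\<^sup>2) \<noteq> 0"
    using False by simp
  have orth: "cinner y (x - scaleC t y) = 0"
    unfolding cinner_diff_right cinner_scaleC_right cinner_self c_def[symmetric] t_def
    using y by simp
  have "complex_of_real ((norm (x - scaleC t y))\<^sup>2) = cinner x (x - scaleC t y)"
    unfolding cinner_self[symmetric] using orth
    by (subst cinner_diff_left) (simp add: cinner_scaleC_left)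
  also have "\<dots> = complex_of_real ((norm x)\<^sup>2 - (cmod c)\<^sup>2 / (norm y)\<^sup>2)"
    unfolding of_real_diff of_real_divide cc
    by (simp add: cinner_diff_right cinner_scaleC_right cinner_self xy t_def)
  finally have "(norm (x - scaleC t y))\<^sup>2 = (norm x)\<^sup>2 - (cmod c)\<^sup>2 / (norm y)\<^sup>2"
    by (simp only: of_real_eq_iff)
  then have "(cmod c)\<^sup>2 / (norm y)\<^sup>2 \<le> (norm x)\<^sup>2"
    using zero_le_power2[of "norm (x - scaleC t y)"] by linarith
  then have "(cmod c)\<^sup>2 \<le> (norm x * norm y)\<^sup>2"
    using False by (simp add: divide_simps power_mult_distrib)
  then have "cmod c \<le> norm x * norm y" by (rule power2_le_imp_le) simp
  then show ?thesis by (simp add: xy)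
qed simp

lemma bounded_linear_cinner: "bounded_linear (cinner (x::'a::complex_hilbert))"
  by (rule bounded_linear_intro[where K = "norm x"])
     (use norm_cinner_le[of x] in \<open>simp_all add: cinner_add_right scaleR_scaleC
       cinner_scaleC_right scaleR_conv_of_real mult.commute\<close>)

lemma bounded_linear_scaleC: "bounded_linear (scaleC c :: 'a::complex_hilbert \<Rightarrow> 'a)"
  by (rule bounded_linear_intro[where K = "cmod c"])
     (simp_all add: scaleC_add_right scaleR_scaleC scaleC_scaleC norm_scaleC mult.commute)

lemma bounded_linear_scaleC_left: "bounded_linear (\<lambda>c. scaleC c (x::'a::complex_hilbert))"
  by (rule bounded_linear_intro[where K = "norm x"])
     (simp_all add: scaleC_add_left scaleR_scaleC scaleC_scaleC norm_scaleC scaleR_conv_of_real)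

lemma cinner_ext:
  assumes "\<And>z. cinner z x = cinner z (y::'a::complex_hilbert)" shows "x = y"
  using assms[of "x - y"] cinner_eq_zero_iff[of "x - y"] by (simp add: cinner_diff_right)

text \<open>Polarization over the complex scalars: testing the form on \<open>x + y\<close> and on \<open>\<i>x + y\<close>
  isolates \<open>\<langle>x, T y\<rangle>\<close>.\<close>

lemma zero_quadratic_form_imp_zero:
  fixes T :: "'a::complex_hilbert \<Rightarrow> 'a"
  assumes add: "\<And>x y. T (x + y) = T x + T y"
    and scale: "\<And>c x. T (scaleC c x) = scaleC c (T x)"
    and form: "\<And>x. cinner x (T x) = 0"
  shows "T y = 0"
proof -
  have sym: "cinner x (T y) + cinner y (T x) = 0" for x y
    using form[of "x + y"] unfolding add cinner_add_left cinner_add_right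
    by (simp add: form add.commute)
  have "cinner x (T y) = 0" for x
    using sym[of x y] sym[of "scaleC \<i> x" y]
    by (simp add: scale cinner_scaleC_left cinner_scaleC_right add_eq_0_iff)
  from this[of "T y"] show ?thesis
    using cinner_eq_zero_iff by blast
qed

section \<open>Self-adjoint operators\<close>

lemma bounded_clinearI:
  assumes "bounded_linear T" "\<And>c x. T (scaleC c x) = scaleC c (T x)"
  shows "bounded_clinear T"
  using assms by (simp add: bounded_clinear_def)

lemma bounded_clinear_simps:
  assumes "bounded_clinear T"
  shows "T (x + y) = T x + T y" "T (x - y) = T x - T y" "T 0 = 0"
    "T (scaleC c x) = scaleC c (T x)" "T (sum g I) = (\<Sum>i\<in>I. T (g i))"
proof -
  interpret bounded_linear T using assms by (simp add: bounded_clinear_def)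
  show "T (x + y) = T x + T y" "T (x - y) = T x - T y" "T 0 = 0" "T (sum g I) = (\<Sum>i\<in>I. T (g i))"
    by (simp_all add: add diff zero sum)
  show "T (scaleC c x) = scaleC c (T x)" using assms by (simp add: bounded_clinear_def)
qed

lemma bounded_clinear_zero: "bounded_clinear (\<lambda>x. 0)"
  by (rule bounded_clinearI) simp_all

lemma bounded_clinear_id: "bounded_clinear (\<lambda>x. x)"
  by (rule bounded_clinearI) (simp_all add: bounded_linear_ident)

lemma bounded_clinear_add:
  "bounded_clinear S \<Longrightarrow> bounded_clinear T \<Longrightarrow> bounded_clinear (\<lambda>x. S x + T x)"
  by (auto simp: bounded_clinear_def scaleC_add_right bounded_linear_add)

lemma bounded_clinear_scaleC: "bounded_clinear T \<Longrightarrow> bounded_clinear (\<lambda>x. scaleC c (T x))"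
  by (auto simp: bounded_clinear_def scaleC_scaleC mult.commute
      intro: bounded_linear_compose[OF bounded_linear_scaleC])

lemma bounded_clinear_sum:
  "(\<And>i. i \<in> I \<Longrightarrow> bounded_clinear (T i)) \<Longrightarrow> bounded_clinear (\<lambda>x. \<Sum>i\<in>I. T i x)"
  by (induction I rule: infinite_finite_induct)
     (simp_all add: bounded_clinear_zero bounded_clinear_add)

lemma bounded_self_adjointI:
  assumes "bounded_clinear T" "\<And>x y. cinner (T x) y = cinner x (T y)"
  shows "bounded_self_adjoint T"
  using assms by (simp add: bounded_self_adjoint_def)

lemma bounded_self_adjoint_zero: "bounded_self_adjoint (\<lambda>x. 0)"
  by (simp add: bounded_self_adjoint_def bounded_clinear_zero)

lemma bounded_self_adjoint_id: "bounded_self_adjoint (\<lambda>x. x)"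
  by (simp add: bounded_self_adjoint_def bounded_clinear_id)

lemma bounded_self_adjoint_add:
  "bounded_self_adjoint S \<Longrightarrow> bounded_self_adjoint T \<Longrightarrow> bounded_self_adjoint (\<lambda>x. S x + T x)"
  by (simp add: bounded_self_adjoint_def bounded_clinear_add cinner_add_left cinner_add_right)

lemma bounded_self_adjoint_scaleC:
  "bounded_self_adjoint T \<Longrightarrow> bounded_self_adjoint (\<lambda>x. scaleC (complex_of_real r) (T x))"
  by (simp add: bounded_self_adjoint_def bounded_clinear_scaleC cinner_scaleC_left cinner_scaleC_right)

lemma bounded_self_adjoint_sum:
  "(\<And>i. i \<in> I \<Longrightarrow> bounded_self_adjoint (T i)) \<Longrightarrow> bounded_self_adjoint (\<lambda>x. \<Sum>i\<in>I. T i x)"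
  by (induction I rule: infinite_finite_induct)
     (simp_all add: bounded_self_adjoint_zero bounded_self_adjoint_add)

lemma bounded_self_adjoint_simps:
  assumes "bounded_self_adjoint T"
  shows "bounded_clinear T" "cinner (T x) y = cinner x (T y)"
  using assms by (auto simp: bounded_self_adjoint_def)

section \<open>Orthonormal families\<close>

definition orthonormal :: "nat \<Rightarrow> (nat \<Rightarrow> 'a::complex_hilbert) \<Rightarrow> bool" where
  "orthonormal n u \<longleftrightarrow> (\<forall>i<n. \<forall>j<n. cinner (u i) (u j) = (if i = j then 1 else 0))"

definition rank_one_proj :: "'a::complex_hilbert \<Rightarrow> 'a \<Rightarrow> 'a" where
  "rank_one_proj u x = scaleC (cinner u x) u"

definition span_proj :: "nat \<Rightarrow> (nat \<Rightarrow> 'a::complex_hilbert) \<Rightarrow> 'a \<Rightarrow> 'a" where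
  "span_proj n u x = (\<Sum>i<n. rank_one_proj (u i) x)"

lemma bounded_self_adjoint_rank_one_proj: "bounded_self_adjoint (rank_one_proj u)"
proof (rule bounded_self_adjointI[OF bounded_clinearI])
  have "bounded_linear (\<lambda>x. scaleC (cinner u x) u)"
    by (rule bounded_linear_compose[OF bounded_linear_scaleC_left bounded_linear_cinner])
  then show "bounded_linear (rank_one_proj u)"
    by (simp add: rank_one_proj_def[abs_def])
  show "rank_one_proj u (scaleC c x) = scaleC c (rank_one_proj u x)" for c x
    by (simp add: rank_one_proj_def scaleC_scaleC cinner_scaleC_right)
  show "cinner (rank_one_proj u x) y = cinner x (rank_one_proj u y)" for x y
    by (simp add: rank_one_proj_def cinner_scaleC_left cinner_scaleC_right)
       (metis cinner_commute mult.commute)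
qed

lemma bounded_self_adjoint_span_proj: "bounded_self_adjoint (span_proj n u)"
  unfolding span_proj_def[abs_def]
  by (rule bounded_self_adjoint_sum) (rule bounded_self_adjoint_rank_one_proj)

lemma cinner_orthonormal_sum:
  assumes "orthonormal n u" "i < n"
  shows "cinner (u i) (\<Sum>j<n. scaleC (c j) (u j)) = c i"
proof -
  have "cinner (u i) (\<Sum>j<n. scaleC (c j) (u j)) = (\<Sum>j<n. if i = j then c j else 0)"
    using assms unfolding cinner_sum_right cinner_scaleC_right orthonormal_def
    by (intro sum.cong) auto
  with assms show ?thesis by simp
qed

lemma cinner_span_proj:
  assumes "orthonormal n u" "i < n"
  shows "cinner (u i) (span_proj n u x) = cinner (u i) x"
  using cinner_orthonormal_sum[OF assms, of "\<lambda>j. cinner (u j) x"]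
  by (simp add: span_proj_def rank_one_proj_def)

lemma span_proj_sum:
  assumes "orthonormal n u"
  shows "span_proj n u (\<Sum>j<n. scaleC (c j) (u j)) = (\<Sum>j<n. scaleC (c j) (u j))"
  unfolding span_proj_def rank_one_proj_def
  by (rule sum.cong) (simp_all add: cinner_orthonormal_sum[OF assms])

lemma span_proj_idem:
  assumes "orthonormal n u"
  shows "span_proj n u (span_proj n u x) = span_proj n u x"
  using span_proj_sum[OF assms, of "\<lambda>j. cinner (u j) x"]
  by (simp add: span_proj_def rank_one_proj_def)

lemma span_proj_basis:
  assumes "orthonormal n u" "i < n" shows "span_proj n u (u i) = u i"
proof -
  have "span_proj n u (u i) = (\<Sum>j<n. if j = i then u i else 0)"
    using assms unfolding span_proj_def rank_one_proj_def orthonormal_def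
    by (intro sum.cong) (auto simp: scaleC_one)
  with assms show ?thesis by simp
qed

lemma span_proj_in_span: "span_proj n u x \<in> complex_vector.span (u ` {..<n})"
  unfolding span_proj_def rank_one_proj_def
  by (intro complex_vector.span_sum complex_vector.span_scale complex_vector.span_base) auto

lemma span_proj_eq_iff:
  assumes "orthonormal n u"
  shows "span_proj n u x = x \<longleftrightarrow> x \<in> complex_vector.span (u ` {..<n})"
proof
  assume "x \<in> complex_vector.span (u ` {..<n})"
  then show "span_proj n u x = x"
    by (induction rule: complex_vector.span_induct_alt)
       (auto simp: bounded_clinear_simps[OF bounded_self_adjoint_simps(1)[OF bounded_self_adjoint_span_proj]]
         span_proj_basis[OF assms])
qed (metis span_proj_in_span)

lemma orthonormal_inj: "orthonormal n u \<Longrightarrow> inj_on u {..<n}"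
  unfolding orthonormal_def inj_on_def by (metis lessThan_iff zero_neq_one)

lemma orthonormal_independent:
  assumes "orthonormal n u"
  shows "complex_vector.independent (u ` {..<n})"
proof (rule complex_vector.independent_if_scalars_zero)
  fix c x assume sum0: "(\<Sum>x\<in>u ` {..<n}. scaleC (c x) x) = 0" and x: "x \<in> u ` {..<n}"
  then obtain i where i: "i < n" "x = u i" by auto
  from sum0 have "(\<Sum>j<n. scaleC (c (u j)) (u j)) = 0"
    by (simp add: sum.reindex[OF orthonormal_inj[OF assms]])
  with cinner_orthonormal_sum[OF assms i(1), of "\<lambda>j. c (u j)"] i show "c x = 0" by simp
qed simp

lemma orthonormal_dim:
  assumes "orthonormal n u"
  shows "complex_vector.dim (complex_vector.span (u ` {..<n})) = n"
  using complex_vector.dim_span_eq_card_independent[OF orthonormal_independent[OF assms]]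
    card_image[OF orthonormal_inj[OF assms]] by simp

text \<open>\<open>n\<close> orthonormal vectors inside an \<open>n\<close>-dimensional space exhaust it, so both families
  have the same projection.\<close>

lemma span_proj_eqI:
  assumes u: "orthonormal n u" and w: "orthonormal n w"
    and sub: "\<And>k. k < n \<Longrightarrow> w k \<in> complex_vector.span (u ` {..<n})"
  shows "span_proj n w x = span_proj n u x"
proof -
  let ?U = "u ` {..<n}" and ?W = "w ` {..<n}"
  have uw: "u i \<in> complex_vector.span ?W" if i: "i < n" for i
  proof (rule ccontr)
    assume notin: "u i \<notin> complex_vector.span ?W"
    then have "complex_vector.independent (insert (u i) ?W)"
      using orthonormal_independent[OF w] by (simp add: complex_vector.independent_insert)
    moreover have "insert (u i) ?W \<subseteq> complex_vector.span ?U"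
      using sub i by (auto intro: complex_vector.span_base)
    ultimately have "card (insert (u i) ?W) \<le> card ?U"
      using complex_vector.independent_span_bound[of ?U "insert (u i) ?W"] by simp
    moreover have "u i \<notin> ?W" using notin complex_vector.span_base[of "u i" ?W] by blast
    ultimately show False
      using orthonormal_inj[OF u] orthonormal_inj[OF w] by (simp add: card_image)
  qed
  have wu: "span_proj n u (span_proj n w x) = span_proj n w x" for x
  proof -
    have "?W \<subseteq> complex_vector.span ?U" using sub by auto
    then have "complex_vector.span ?W \<subseteq> complex_vector.span ?U"
      by (simp add: complex_vector.span_minimal complex_vector.subspace_span)
    then show ?thesis unfolding span_proj_eq_iff[OF u] using span_proj_in_span[of n w x] by (rule subsetD)
  qed
  have uw': "span_proj n w (span_proj n u x) = span_proj n u x" for x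
  proof -
    have "?U \<subseteq> complex_vector.span ?W" using uw by auto
    then have "complex_vector.span ?U \<subseteq> complex_vector.span ?W"
      by (simp add: complex_vector.span_minimal complex_vector.subspace_span)
    then show ?thesis unfolding span_proj_eq_iff[OF w] using span_proj_in_span[of n u x] by (rule subsetD)
  qed
  show ?thesis
  proof (rule cinner_ext)
    fix z
    have "cinner z (span_proj n w x) = cinner z (span_proj n u (span_proj n w x))"
      by (simp add: wu)
    also have "\<dots> = cinner (span_proj n w (span_proj n u z)) x"
      by (simp only: bounded_self_adjoint_simps(2)[OF bounded_self_adjoint_span_proj])
    also have "\<dots> = cinner z (span_proj n u x)"
      by (simp only: uw' bounded_self_adjoint_simps(2)[OF bounded_self_adjoint_span_proj])
    finally show "cinner z (span_proj n w x) = cinner z (span_proj n u x)" .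
  qed
qed

text \<open>Gram--Schmidt: a finite orthonormal family does not span the space, so some vector has a nonzero
  component orthogonal to it, which can be normalized and appended.\<close>

lemma orthonormal_exists:
  assumes "infinite_dimensional TYPE('a::complex_hilbert)"
  shows "\<exists>u :: nat \<Rightarrow> 'a. orthonormal n u"
proof (induction n)
  case 0
  show ?case by (simp add: orthonormal_def)
next
  case (Suc n)
  then obtain u :: "nat \<Rightarrow> 'a" where u: "orthonormal n u" by blast
  have "complex_vector.span (u ` {..<n}) \<noteq> UNIV"
    using assms unfolding infinite_dimensional_def by blast
  then obtain x where x: "x \<notin> complex_vector.span (u ` {..<n})" by blast
  define y where "y = x - span_proj n u x"
  have y0: "y \<noteq> 0" using x span_proj_in_span[of n u x] by (auto simp: y_def)
  have orth: "cinner (u i) y = 0" "cinner y (u i) = 0" if "i < n" for i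
  proof -
    show "cinner (u i) y = 0"
      using cinner_span_proj[OF u that] by (simp add: y_def cinner_diff_right)
    then show "cinner y (u i) = 0" by (subst cinner_commute) simp
  qed
  define e where "e = scaleC (complex_of_real (1 / norm y)) y"
  have "norm e = 1"
    unfolding e_def norm_scaleC using y0 by (simp add: norm_divide)
  then have "cinner e e = 1" by (simp add: cinner_self)
  then have "orthonormal (Suc n) (u(n := e))"
    using u orth by (auto simp: orthonormal_def less_Suc_eq e_def cinner_scaleC_left cinner_scaleC_right)
  then show ?case by blast
qed

section \<open>Projection-valued measures and eigenvectors\<close>

locale pvm =
  fixes E :: "real set \<Rightarrow> 'a::complex_hilbert \<Rightarrow> 'a"
  assumes pvm: "projection_valued_measure E"
begin

lemma
  assumes "S \<in> sets borel"
  shows clinear: "bounded_clinear (E S)"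
    and idem: "E S (E S x) = E S x"
    and sym: "cinner (E S x) y = cinner x (E S y)"
proof -
  have sa: "bounded_self_adjoint (E S)"
    using pvm assms unfolding projection_valued_measure_def by blast
  show "bounded_clinear (E S)" "cinner (E S x) y = cinner x (E S y)"
    by (fact bounded_self_adjoint_simps[OF sa])+
  have "E S \<circ> E S = E S"
    using pvm assms unfolding projection_valued_measure_def by blast
  then show "E S (E S x) = E S x" by (metis comp_apply)
qed

lemma UNIV_eq: "E UNIV x = x"
  using pvm by (simp add: projection_valued_measure_def)

lemma not_borel: "S \<notin> sets borel \<Longrightarrow> E S x = 0"
  using pvm by (simp add: projection_valued_measure_def)

lemma sums_Union:
  "range F \<subseteq> sets borel \<Longrightarrow> disjoint_family F \<Longrightarrow> (\<lambda>n. E (F n) x) sums E (\<Union>n. F n) x"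
  for F :: "nat \<Rightarrow> real set"
  using pvm by (simp add: projection_valued_measure_def)

lemma empty_eq: "E {} x = 0"
proof -
  have "(\<lambda>n::nat. E {} x) sums E {} x"
    using sums_Union[of "\<lambda>_. {}" x] by (simp add: disjoint_family_on_def)
  then have "summable (\<lambda>n::nat. E {} x)" by (rule sums_summable)
  then show ?thesis using summable_LIMSEQ_zero LIMSEQ_unique tendsto_const by blast
qed

lemma Un_eq:
  assumes "S \<in> sets borel" "U \<in> sets borel" "S \<inter> U = {}"
  shows "E (S \<union> U) x = E S x + E U x"
proof -
  define F :: "nat \<Rightarrow> real set" where "F n = (if n = 0 then S else if n = 1 then U else {})" for n
  have "(\<lambda>n. E (F n) x) sums E (\<Union>n. F n) x"
    using assms by (intro sums_Union) (auto simp: F_def disjoint_family_on_def)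
  moreover have "(\<Union>n. F n) = S \<union> U"
    by (auto simp: F_def split: if_splits)
  moreover have "(\<lambda>n. E (F n) x) sums (\<Sum>n\<in>{0, 1}. E (F n) x)"
    by (rule sums_finite) (auto simp: F_def empty_eq)
  then have "(\<lambda>n. E (F n) x) sums (E S x + E U x)"
    by (simp add: F_def)
  ultimately show ?thesis using sums_unique2 by metis
qed

lemma Compl_eq: "S \<in> sets borel \<Longrightarrow> E (- S) x = x - E S x"
  using Un_eq[of S "- S" x] UNIV_eq[of x] by (simp add: Compl_partition algebra_simps borel_comp)

text \<open>A sum \<open>P + Q\<close> of projections is idempotent only if \<open>P Q + Q P = 0\<close>; multiplying by \<open>P\<close>
  from either side gives \<open>P Q = Q P\<close>, so both products vanish.\<close>

lemma disjoint_mult: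
  assumes S: "S \<in> sets borel" and U: "U \<in> sets borel" and "S \<inter> U = {}"
  shows "E S (E U x) = 0"
proof -
  note lin = bounded_clinear_simps[OF clinear[OF S]] bounded_clinear_simps[OF clinear[OF U]]
  have anti: "E S (E U y) + E U (E S y) = 0" for y
  proof -
    have "E (S \<union> U) (E (S \<union> U) y) = E (S \<union> U) y"
      using S U by (intro idem) auto
    then show ?thesis
      by (simp add: Un_eq[OF assms] lin idem[OF S] idem[OF U] algebra_simps)
  qed
  have "E S (E U (E S x)) = - E S (E U x)"
    using arg_cong[OF anti[of x], of "E S"] by (simp add: lin idem[OF S] add_eq_0_iff)
  moreover have "E S (E U (E S x)) = - E U (E S x)"
    using anti[of "E S x"] by (simp add: idem[OF S] eq_neg_iff_add_eq_0)
  ultimately have "E S (E U x) = E U (E S x)" by simp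
  with anti[of x] have "2 *\<^sub>R E S (E U x) = 0" by (simp add: scaleR_2)
  then show ?thesis by simp
qed

lemma mult_eq:
  assumes S: "S \<in> sets borel" and U: "U \<in> sets borel"
  shows "E S (E U x) = E (S \<inter> U) x"
proof -
  have "E U x = E (S \<inter> U) x + E (U - S) x"
  proof -
    have "S \<inter> U \<union> (U - S) = U" by auto
    then show ?thesis using Un_eq[of "S \<inter> U" "U - S" x] S U by auto
  qed
  moreover have "E S (E (U - S) x) = 0"
    using S U by (intro disjoint_mult) auto
  moreover have "E S (E (S \<inter> U) x) = E (S \<inter> U) (E (S \<inter> U) x) + E (S - U) (E (S \<inter> U) x)"
  proof -
    have "S \<inter> U \<union> (S - U) = S" by auto
    then show ?thesis using Un_eq[of "S \<inter> U" "S - U" "E (S \<inter> U) x"] S U by auto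
  qed
  moreover have "E (S - U) (E (S \<inter> U) x) = 0"
    using S U by (intro disjoint_mult) auto
  moreover have "E (S \<inter> U) (E (S \<inter> U) x) = E (S \<inter> U) x"
    using S U by (intro idem) auto
  ultimately show ?thesis
    by (simp add: bounded_clinear_simps[OF clinear[OF S]])
qed

lemma cinner_eq_norm:
  assumes "S \<in> sets borel" shows "cinner x (E S x) = complex_of_real ((norm (E S x))\<^sup>2)"
  using sym[OF assms, of x "E S x"] by (simp add: idem[OF assms] cinner_self)

lemma sets_scalar_measure [measurable_cong]: "sets (scalar_measure E x) = sets borel"
  unfolding scalar_measure_def using sets.sigma_sets_eq[of "borel :: real measure"] by simp

lemma space_scalar_measure: "space (scalar_measure E x) = UNIV"
  by (simp add: scalar_measure_def)

lemma emeasure_scalar_measure: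
  assumes "S \<in> sets borel"
  shows "emeasure (scalar_measure E x) S = ennreal ((norm (E S x))\<^sup>2)"
proof -
  have "emeasure (scalar_measure E x) S = ennreal (Re (cinner x (E S x)))"
  proof (rule emeasure_measure_of[OF scalar_measure_def])
    show "S \<in> sets (scalar_measure E x)" using assms by (simp add: sets_scalar_measure)
    show "positive (sets (scalar_measure E x)) (\<lambda>S. ennreal (Re (cinner x (E S x))))"
      by (simp add: positive_def empty_eq)
    show "countably_additive (sets (scalar_measure E x)) (\<lambda>S. ennreal (Re (cinner x (E S x))))"
      unfolding sets_scalar_measure
    proof (rule countably_additiveI)
      fix F :: "nat \<Rightarrow> real set"
      assume F: "range F \<subseteq> sets borel" "disjoint_family F"
      have "(\<lambda>n. cinner x (E (F n) x)) sums cinner x (E (\<Union>n. F n) x)"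
        by (rule bounded_linear.sums[OF bounded_linear_cinner sums_Union[OF F]])
      then have sums: "(\<lambda>n. Re (cinner x (E (F n) x))) sums Re (cinner x (E (\<Union>n. F n) x))"
        by (rule sums_Re)
      have "0 \<le> Re (cinner x (E (F n) x))" for n
        using F(1) by (subst cinner_eq_norm) auto
      with sums show "(\<Sum>n. ennreal (Re (cinner x (E (F n) x)))) = ennreal (Re (cinner x (E (\<Union>n. F n) x)))"
        by (simp add: suminf_ennreal2 sums_iff)
    qed
  qed auto
  then show ?thesis by (simp add: cinner_eq_norm[OF assms])
qed

lemma finite_scalar_measure: "finite_measure (scalar_measure E x)"
  by (rule finite_measureI) (simp add: space_scalar_measure emeasure_scalar_measure)

lemma measure_space_scalar_measure:
  "measure (scalar_measure E x) (space (scalar_measure E x)) = (norm x)\<^sup>2"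
  by (simp add: measure_def space_scalar_measure emeasure_scalar_measure UNIV_eq)

text \<open>Since \<open>E U\<close> and \<open>E S\<close> commute, \<open>\<langle>E S x, E U (E S x)\<rangle> = \<langle>x, E (U \<inter> S) x\<rangle>\<close>.\<close>

lemma scalar_measure_restrict:
  assumes S: "S \<in> sets borel"
  shows "scalar_measure E (E S x) = density (scalar_measure E x) (indicator S)"
proof (rule measure_eqI)
  fix U assume "U \<in> sets (scalar_measure E (E S x))"
  then have U: "U \<in> sets borel" by (simp add: sets_scalar_measure)
  with S show "emeasure (scalar_measure E (E S x)) U = emeasure (density (scalar_measure E x) (indicator S)) U"
    by (simp add: emeasure_restricted sets_scalar_measure emeasure_scalar_measure mult_eq Int_commute)
qed (simp add: sets_scalar_measure)

lemma AE_scalar_measure: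
  assumes "S \<in> sets borel" "E S x = x"
  shows "AE t in scalar_measure E x. t \<in> S"
proof (rule AE_I)
  show "{t \<in> space (scalar_measure E x). t \<notin> S} \<subseteq> - S" by auto
  show "emeasure (scalar_measure E x) (- S) = 0"
    using assms by (simp add: emeasure_scalar_measure Compl_eq borel_comp)
  show "- S \<in> sets (scalar_measure E x)" using assms by (simp add: sets_scalar_measure borel_comp)
qed

text \<open>The quadratic form of \<open>A\<close> is the first moment of the scalar measures.  It splits along \<open>E S\<close>
  because the measures of the two components of \<open>x\<close> are the restrictions of the measure of \<open>x\<close> to
  \<open>S\<close> and to its complement.  This is how \<open>A\<close> is seen to commute with \<open>E S\<close> below.\<close>

lemma form_split:
  assumes bounded: "E {- r..r} = id"
    and form: "\<And>x. cinner x (A x) = complex_of_real (\<integral>t. t \<partial>scalar_measure E x)"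
    and S: "S \<in> sets borel"
  shows "cinner x (A x) = cinner (E S x) (A (E S x)) + cinner (E (- S) x) (A (E (- S) x))"
proof -
  let ?M = "scalar_measure E x"
  have S': "- S \<in> sets borel" using S by (simp add: borel_comp)
  have "AE t in ?M. t \<in> {- r..r}"
    using bounded by (intro AE_scalar_measure) auto
  then have int: "integrable ?M (\<lambda>t. t)"
    by (intro finite_measure.integrable_const_bound[OF finite_scalar_measure, where B = r])
       (auto simp: space_scalar_measure)
  have restr: "(\<integral>t. t \<partial>scalar_measure E (E U x)) = (\<integral>t. indicator U t *\<^sub>R t \<partial>?M)"
    if U: "U \<in> sets borel" for U
    unfolding scalar_measure_restrict[OF U] ennreal_indicator[symmetric]
    by (rule integral_density) (use U in auto)
  have intU: "integrable ?M (\<lambda>t. indicator U t *\<^sub>R t)" if U: "U \<in> sets borel" for U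
    using U int by (intro integrable_mult_indicator) (auto simp: sets_scalar_measure)
  have "(\<integral>t. t \<partial>?M) = (\<integral>t. indicator S t *\<^sub>R t + indicator (- S) t *\<^sub>R t \<partial>?M)"
    by (rule Bochner_Integration.integral_cong) (auto simp: indicator_def)
  also have "\<dots> = (\<integral>t. t \<partial>scalar_measure E (E S x)) + (\<integral>t. t \<partial>scalar_measure E (E (- S) x))"
    unfolding restr[OF S] restr[OF S']
    by (rule Bochner_Integration.integral_add[OF intU[OF S] intU[OF S']])
  finally show ?thesis by (simp add: form)
qed

text \<open>The splitting of the form kills the real part of every cross term between the range of \<open>E S\<close>
  and its complement; replacing a vector \<open>y\<close> by \<open>\<i> y\<close> kills the imaginary part as well.\<close>

lemma off_diagonal_zero:
  assumes A: "bounded_clinear A"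
    and bounded: "E {- r..r} = id"
    and form: "\<And>x. cinner x (A x) = complex_of_real (\<integral>t. t \<partial>scalar_measure E x)"
    and S: "S \<in> sets borel"
  shows "cinner (E S u) (A (E (- S) w)) = 0"
proof -
  define z where "z = E (- S) w"
  have S': "- S \<in> sets borel" using S by (simp add: borel_comp)
  note lin = bounded_clinear_simps[OF clinear[OF S]] bounded_clinear_simps[OF clinear[OF S']]
  have cross: "cinner y (A z) + cinner z (A y) = 0" if y: "E S y = y" for y
  proof -
    have "E S z = 0" "E (- S) y = 0" "E (- S) z = z"
      using disjoint_mult[OF S S', of w] Compl_eq[OF S, of y] y idem[OF S', of w] by (auto simp: z_def)
    then show ?thesis
      using form_split[OF bounded form S, of "y + z"] y
      by (simp add: lin bounded_clinear_simps[OF A] cinner_add_left cinner_add_right add.commute)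
  qed
  have "cinner (E S u) (A z) + cinner z (A (E S u)) = 0"
    by (rule cross) (rule idem[OF S])
  moreover have "cinner (scaleC \<i> (E S u)) (A z) + cinner z (A (scaleC \<i> (E S u))) = 0"
    by (rule cross) (simp add: lin idem[OF S])
  ultimately show ?thesis
    unfolding z_def
    by (simp add: bounded_clinear_simps[OF A] cinner_scaleC_left cinner_scaleC_right add_eq_0_iff)
qed

text \<open>Let \<open>A x = l x\<close>, and let \<open>y\<close> be the component of \<open>x\<close> in the spectral subspace of a set
  on one side of \<open>l\<close>.  Then \<open>y\<close> has mean energy \<open>l\<close>, although its measure charges only
  one side of \<open>l\<close>; so \<open>y = 0\<close>.\<close>

lemma one_sided_component_zero:
  assumes A: "bounded_clinear A"
    and bounded: "E {- r..r} = id"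
    and form: "\<And>x. cinner x (A x) = complex_of_real (\<integral>t. t \<partial>scalar_measure E x)"
    and x: "A x = scaleC (complex_of_real l) x"
    and S: "S \<in> sets borel" and side: "\<And>t. t \<in> S \<Longrightarrow> 0 < s * (t - l)"
  shows "E S x = 0"
proof -
  define y where "y = E S x"
  let ?M = "scalar_measure E y"
  interpret M: finite_measure ?M by (rule finite_scalar_measure)
  have decomp: "x = y + E (- S) x" by (simp add: y_def Compl_eq[OF S])
  have "A x = A y + A (E (- S) x)"
    using arg_cong[OF decomp, of A] by (simp add: bounded_clinear_simps[OF A])
  then have "cinner y (A y) = cinner y (A x)"
    using off_diagonal_zero[OF A bounded form S, of x x] by (simp add: cinner_add_right y_def)
  also have "\<dots> = complex_of_real l * complex_of_real ((norm y)\<^sup>2)"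
    using sym[OF S, of x "E S x"] sym[OF S, of x x] cinner_eq_norm[OF S, of x]
    by (simp add: x cinner_scaleC_right y_def)
  finally have "complex_of_real (\<integral>t. t \<partial>?M) = complex_of_real (l * (norm y)\<^sup>2)"
    by (simp add: form)
  then have mean: "(\<integral>t. t \<partial>?M) = l * (norm y)\<^sup>2" by (simp only: of_real_eq_iff)
  have "AE t in ?M. t \<in> {- r..r}"
    using bounded by (intro AE_scalar_measure) auto
  then have int: "integrable ?M (\<lambda>t. t)"
    by (intro M.integrable_const_bound[where B = r]) (auto simp: space_scalar_measure)
  then have int': "integrable ?M (\<lambda>t. s * (t - l))" by simp
  have AE_S: "AE t in ?M. t \<in> S"
    using S by (intro AE_scalar_measure) (simp_all add: y_def idem)
  then have "AE t in ?M. 0 \<le> s * (t - l)"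
    by eventually_elim (use side in \<open>auto intro: less_imp_le\<close>)
  moreover have "(\<integral>t. s * (t - l) \<partial>?M) = 0"
    using int mean by (simp add: measure_space_scalar_measure)
  ultimately have "AE t in ?M. s * (t - l) = 0"
    using integral_nonneg_eq_0_iff_AE[OF int'] by blast
  with AE_S have "AE t in ?M. False"
    by eventually_elim (use side in fastforce)
  then have "space ?M \<in> null_sets ?M"
    by (subst AE_iff_null_sets) auto
  then have "emeasure ?M (space ?M) = 0" by auto
  then show ?thesis
    by (simp add: space_scalar_measure emeasure_scalar_measure UNIV_eq y_def)
qed

text \<open>Both half-lines next to the eigenvalue contribute nothing, so \<open>E {l}\<close> fixes the eigenvector and
  multiplicativity determines the other values.  This pins down the spectral measure of any
  operator whose eigenvectors span the space.\<close>

lemma eigenvector_eq: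
  assumes A: "bounded_clinear A"
    and bounded: "E {- r..r} = id"
    and form: "\<And>x. cinner x (A x) = complex_of_real (\<integral>t. t \<partial>scalar_measure E x)"
    and x: "A x = scaleC (complex_of_real l) x"
    and S: "S \<in> sets borel"
  shows "E S x = (if l \<in> S then x else 0)"
proof -
  have "E {l<..} x = 0" "E {..<l} x = 0"
    by (rule one_sided_component_zero[OF A bounded form x, of _ 1]; simp)
       (rule one_sided_component_zero[OF A bounded form x, of _ "-1"]; simp)
  moreover have "- {l} = {l<..} \<union> {..<l}" by auto
  ultimately have "E (- {l}) x = 0"
    using Un_eq[of "{l<..}" "{..<l}" x] by (simp add: disjoint_iff)
  then have "E {l} x = x" by (simp add: Compl_eq)
  then show ?thesis
    using mult_eq[OF S, of "{l}" x] by (auto simp: empty_eq)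
qed

end

section \<open>Functional calculus of operators with finite spectrum\<close>

text \<open>A finite family of mutually orthogonal projections with sum \<open>1\<close>.  The eigenvalues attached to
  the projections are kept separate and may repeat, so that no projections have to be merged
  when the same number occurs twice.\<close>

locale finite_resolution =
  fixes I :: "'i set" and P :: "'i \<Rightarrow> 'a::complex_hilbert \<Rightarrow> 'a"
  assumes finite: "finite I"
    and proj: "\<And>i. i \<in> I \<Longrightarrow> bounded_self_adjoint (P i)"
    and orth: "\<And>i j x. i \<in> I \<Longrightarrow> j \<in> I \<Longrightarrow> P i (P j x) = (if i = j then P i x else 0)"
    and total: "\<And>x. (\<Sum>i\<in>I. P i x) = x"
begin

definition diag_op :: "('i \<Rightarrow> complex) \<Rightarrow> 'a \<Rightarrow> 'a" where
  "diag_op c x = (\<Sum>i\<in>I. scaleC (c i) (P i x))"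

definition diag_pvm :: "('i \<Rightarrow> real) \<Rightarrow> real set \<Rightarrow> 'a \<Rightarrow> 'a" where
  "diag_pvm l S x = (if S \<in> sets borel then \<Sum>i\<in>I. if l i \<in> S then P i x else 0 else 0)"

lemma clinear: "i \<in> I \<Longrightarrow> bounded_clinear (P i)"
  by (rule bounded_self_adjoint_simps(1)[OF proj])

lemma cinner_P: "i \<in> I \<Longrightarrow> cinner x (P i x) = complex_of_real ((norm (P i x))\<^sup>2)"
  using bounded_self_adjoint_simps(2)[OF proj, of i x "P i x"] by (simp add: orth cinner_self)

lemma diag_op_clinear: "bounded_clinear (diag_op c)"
  unfolding diag_op_def[abs_def]
  by (intro bounded_clinear_sum bounded_clinear_scaleC clinear)

lemma diag_op_self_adjoint: "bounded_self_adjoint (diag_op (\<lambda>i. complex_of_real (l i)))"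
  unfolding diag_op_def[abs_def]
  by (intro bounded_self_adjoint_sum bounded_self_adjoint_scaleC proj)

lemma diag_op_P:
  assumes "j \<in> I" shows "diag_op c (P j x) = scaleC (c j) (P j x)"
proof -
  have "diag_op c (P j x) = (\<Sum>i\<in>I. if i = j then scaleC (c j) (P j x) else 0)"
    unfolding diag_op_def by (rule sum.cong) (use assms in \<open>auto simp: orth\<close>)
  with assms finite show ?thesis by simp
qed

lemma cinner_diag_op: "cinner x (diag_op c x) = (\<Sum>i\<in>I. (norm (P i x))\<^sup>2 *\<^sub>R c i)"
  unfolding diag_op_def cinner_sum_right
  by (rule sum.cong) (simp_all add: cinner_scaleC_right cinner_P scaleR_conv_of_real mult.commute)

lemma diag_pvm: "projection_valued_measure (diag_pvm l)"
  unfolding projection_valued_measure_def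
proof (intro conjI ballI allI impI)
  fix S :: "real set" assume S: "S \<in> sets borel"
  show "bounded_self_adjoint (diag_pvm l S)"
  proof -
    have "bounded_self_adjoint (\<lambda>x. \<Sum>i\<in>I. if l i \<in> S then P i x else 0)"
    proof (rule bounded_self_adjoint_sum)
      fix i assume "i \<in> I"
      then show "bounded_self_adjoint (\<lambda>x. if l i \<in> S then P i x else 0)"
        using proj[of i] bounded_self_adjoint_zero by (cases "l i \<in> S") simp_all
    qed
    with S show ?thesis by (simp add: diag_pvm_def[abs_def])
  qed
  show "diag_pvm l S \<circ> diag_pvm l S = diag_pvm l S"
  proof
    fix x
    have PS: "P i (diag_pvm l S x) = (if l i \<in> S then P i x else 0)" if i: "i \<in> I" for i
    proof -
      have "P i (diag_pvm l S x) = (\<Sum>j\<in>I. P i (if l j \<in> S then P j x else 0))"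
        using S by (simp add: diag_pvm_def bounded_clinear_simps(5)[OF clinear[OF i]])
      also have "\<dots> = (\<Sum>j\<in>I. if j = i then (if l i \<in> S then P i x else 0) else 0)"
        by (rule sum.cong) (use i in \<open>auto simp: orth bounded_clinear_simps(3)[OF clinear[OF i]]\<close>)
      finally have "P i (diag_pvm l S x) =
          (\<Sum>j\<in>I. if j = i then (if l i \<in> S then P i x else 0) else 0)" .
      with i finite show ?thesis by simp
    qed
    have "diag_pvm l S (diag_pvm l S x) = (\<Sum>i\<in>I. if l i \<in> S then P i (diag_pvm l S x) else 0)"
      using S by (subst diag_pvm_def) simp
    also have "\<dots> = (\<Sum>i\<in>I. if l i \<in> S then P i x else 0)"
      by (rule sum.cong) (simp_all add: PS)
    also have "\<dots> = diag_pvm l S x" using S by (simp add: diag_pvm_def)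
    finally show "(diag_pvm l S \<circ> diag_pvm l S) x = diag_pvm l S x" by simp
  qed
next
  show "diag_pvm l UNIV = id"
    by (rule ext) (simp add: diag_pvm_def total)
next
  fix F :: "nat \<Rightarrow> real set" and x
  assume F: "range F \<subseteq> sets borel" "disjoint_family F"
  have single: "(\<lambda>n. if l i \<in> F n then P i x else 0) sums (if l i \<in> (\<Union>n. F n) then P i x else 0)" for i
  proof (cases "l i \<in> (\<Union>n. F n)")
    case True
    then obtain m where m: "l i \<in> F m" by auto
    have "l i \<in> F n \<longleftrightarrow> n = m" for n
      using m F(2) by (auto simp: disjoint_family_on_def)
    then show ?thesis using sums_single[of m "\<lambda>_. P i x"] True by simp
  qed simp
  have "(\<lambda>n. \<Sum>i\<in>I. if l i \<in> F n then P i x else 0) sums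
      (\<Sum>i\<in>I. if l i \<in> (\<Union>n. F n) then P i x else 0)"
    by (rule sums_sum) (rule single)
  moreover have "F n \<in> sets borel" for n using F(1) by auto
  moreover from this have "(\<Union>n. F n) \<in> sets borel" by auto
  ultimately show "(\<lambda>n. diag_pvm l (F n) x) sums diag_pvm l (\<Union>n. F n) x"
    by (simp add: diag_pvm_def)
next
  fix S :: "real set" assume "S \<notin> sets borel"
  then show "diag_pvm l S = (\<lambda>x. 0)" by (simp add: diag_pvm_def[abs_def])
qed

text \<open>The measure is a finite sum of point masses.  Presenting it as an image of a measure on the index
  set turns integrals into finite sums without a discussion of coinciding eigenvalues.\<close>

lemma scalar_measure_diag_pvm:
  "scalar_measure (diag_pvm l) x = distr (point_measure I (\<lambda>i. (norm (P i x))\<^sup>2)) borel l"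
proof (rule measure_eqI)
  interpret pvm "diag_pvm l" by unfold_locales (rule diag_pvm)
  show "sets (scalar_measure (diag_pvm l) x) = sets (distr (point_measure I (\<lambda>i. (norm (P i x))\<^sup>2)) borel l)"
    by (simp add: sets_scalar_measure)
  fix S assume "S \<in> sets (scalar_measure (diag_pvm l) x)"
  then have S: "S \<in> sets borel" by (simp add: sets_scalar_measure)
  have "cinner x (diag_pvm l S x) = complex_of_real (\<Sum>i\<in>I. if l i \<in> S then (norm (P i x))\<^sup>2 else 0)"
    using S unfolding diag_pvm_def of_real_sum
    by (simp add: cinner_sum_right) (rule sum.cong, auto simp: cinner_P)
  then have "complex_of_real ((norm (diag_pvm l S x))\<^sup>2) =
      complex_of_real (\<Sum>i\<in>I. if l i \<in> S then (norm (P i x))\<^sup>2 else 0)"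
    by (simp only: cinner_eq_norm[OF S])
  then have "(norm (diag_pvm l S x))\<^sup>2 = (\<Sum>i\<in>I. if l i \<in> S then (norm (P i x))\<^sup>2 else 0)"
    by (simp only: of_real_eq_iff)
  also have "\<dots> = (\<Sum>i\<in>{i\<in>I. l i \<in> S}. (norm (P i x))\<^sup>2)"
    using finite by (simp add: sum.If_cases Collect_conj_eq Int_commute)
  finally have "emeasure (scalar_measure (diag_pvm l) x) S = (\<Sum>i\<in>{i\<in>I. l i \<in> S}. ennreal ((norm (P i x))\<^sup>2))"
    by (simp add: emeasure_scalar_measure[OF S] sum_nonneg)
  also have "\<dots> = emeasure (point_measure I (\<lambda>i. (norm (P i x))\<^sup>2)) {i\<in>I. l i \<in> S}"
    using finite by (subst emeasure_point_measure_finite) auto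
  also have "\<dots> = emeasure (distr (point_measure I (\<lambda>i. (norm (P i x))\<^sup>2)) borel l) S"
    using S by (subst emeasure_distr) (auto simp: measurable_point_measure_eq1 space_point_measure
        intro!: arg_cong2[of _ _ _ _ emeasure])
  finally show "emeasure (scalar_measure (diag_pvm l) x) S =
      emeasure (distr (point_measure I (\<lambda>i. (norm (P i x))\<^sup>2)) borel l) S" .
qed

lemma integral_scalar_measure:
  fixes f :: "real \<Rightarrow> 'b::{banach, second_countable_topology}"
  assumes "f \<in> borel_measurable borel"
  shows "(\<integral>t. f t \<partial>scalar_measure (diag_pvm l) x) = (\<Sum>i\<in>I. (norm (P i x))\<^sup>2 *\<^sub>R f (l i))"
  unfolding scalar_measure_diag_pvm using assms
  by (subst integral_distr)
     (auto simp: measurable_point_measure_eq1 lebesgue_integral_point_measure_finite[OF finite])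

lemma nn_integral_scalar_measure:
  fixes f :: "real \<Rightarrow> ennreal"
  assumes "f \<in> borel_measurable borel"
  shows "(\<integral>\<^sup>+t. f t \<partial>scalar_measure (diag_pvm l) x) = (\<Sum>i\<in>I. ennreal ((norm (P i x))\<^sup>2) * f (l i))"
  unfolding scalar_measure_diag_pvm using assms
  by (subst nn_integral_distr)
     (auto simp: measurable_point_measure_eq1 nn_integral_point_measure_finite[OF finite])

text \<open>Every vector is a sum of the eigenvectors \<open>P i x\<close>, on which any representing measure is determined.\<close>

lemma spectral_measure_diag_op:
  "spectral_measure (diag_op (\<lambda>i. complex_of_real (l i))) = diag_pvm l"
  unfolding spectral_measure_def
proof (rule the_equality)
  let ?A = "diag_op (\<lambda>i. complex_of_real (l i))"
  define r where "r = (\<Sum>i\<in>I. \<bar>l i\<bar>)"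
  have "\<bar>l i\<bar> \<le> r" if "i \<in> I" for i
    unfolding r_def using finite that by (intro member_le_sum) auto
  then have "l i \<in> {- r..r}" if "i \<in> I" for i using that by (force simp: abs_le_iff)
  then have "diag_pvm l {- r..r} x = x" for x
    by (simp add: diag_pvm_def total del: atLeastAtMost_iff)
  then have "diag_pvm l {- r..r} = id" by auto
  moreover have "cinner x (?A x) = complex_of_real (\<integral>t. t \<partial>scalar_measure (diag_pvm l) x)" for x
    by (simp add: cinner_diag_op integral_scalar_measure scaleR_conv_of_real)
  ultimately show "projection_valued_measure (diag_pvm l) \<and> (\<exists>r. diag_pvm l {- r..r} = id) \<and>
      (\<forall>x. cinner x (?A x) = complex_of_real (\<integral>t. t \<partial>scalar_measure (diag_pvm l) x))"
    using diag_pvm by blast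
next
  let ?A = "diag_op (\<lambda>i. complex_of_real (l i))"
  fix E
  assume E: "projection_valued_measure E \<and> (\<exists>r. E {- r..r} = id) \<and>
      (\<forall>x. cinner x (?A x) = complex_of_real (\<integral>t. t \<partial>scalar_measure E x))"
  then interpret E: pvm E by unfold_locales simp
  from E obtain r where r: "E {- r..r} = id" by blast
  from E have form: "\<And>x. cinner x (?A x) = complex_of_real (\<integral>t. t \<partial>scalar_measure E x)" by blast
  show "E = diag_pvm l"
  proof (intro ext)
    fix S x
    show "E S x = diag_pvm l S x"
    proof (cases "S \<in> sets borel")
      case True
      have "E S x = E S (\<Sum>i\<in>I. P i x)" by (simp add: total)
      also have "\<dots> = (\<Sum>i\<in>I. E S (P i x))"
        by (rule bounded_clinear_simps[OF E.clinear[OF True]])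
      also have "\<dots> = (\<Sum>i\<in>I. if l i \<in> S then P i x else 0)"
        by (rule sum.cong[OF refl])
           (rule E.eigenvector_eq[OF diag_op_clinear r form diag_op_P True])
      finally show ?thesis using True by (simp add: diag_pvm_def)
    qed (simp add: E.not_borel diag_pvm_def)
  qed
qed

lemma borel_calculus_dom_diag_op:
  assumes "f \<in> borel_measurable borel"
  shows "borel_calculus_dom f (diag_op (\<lambda>i. complex_of_real (l i))) = UNIV"
proof -
  have "(\<integral>\<^sup>+t. ennreal ((cmod (f t))\<^sup>2) \<partial>scalar_measure (diag_pvm l) x) < \<infinity>" for x
    using assms finite by (subst nn_integral_scalar_measure)
      (auto simp: ennreal_mult_less_top less_top[symmetric] ennreal_mult_eq_top_iff)
  then show ?thesis by (auto simp: borel_calculus_dom_def spectral_measure_diag_op)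
qed

text \<open>The domain is the whole space, and there the quadratic form determines the operator by
  polarization.\<close>

lemma borel_calculus_diag_op:
  assumes f: "f \<in> borel_measurable borel"
  shows "borel_calculus f (diag_op (\<lambda>i. complex_of_real (l i))) = diag_op (\<lambda>i. f (l i))"
  unfolding borel_calculus_def Let_def borel_calculus_dom_diag_op[OF f] spectral_measure_diag_op
    integral_scalar_measure[OF f]
proof (rule the_equality)
  fix T :: "'a \<Rightarrow> 'a"
  assume T: "(\<forall>x\<in>UNIV. \<forall>y\<in>UNIV. T (x + y) = T x + T y) \<and>
    (\<forall>c. \<forall>x\<in>UNIV. T (scaleC c x) = scaleC c (T x)) \<and>
    (\<forall>x\<in>UNIV. cinner x (T x) = (\<Sum>i\<in>I. (norm (P i x))\<^sup>2 *\<^sub>R f (l i))) \<and>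
    (\<forall>x. x \<notin> UNIV \<longrightarrow> T x = 0)"
  note lin = bounded_clinear_simps[OF diag_op_clinear]
  have "T x - diag_op (\<lambda>i. f (l i)) x = 0" for x
    by (rule zero_quadratic_form_imp_zero[where T = "\<lambda>x. T x - diag_op (\<lambda>i. f (l i)) x"])
       (use T in \<open>simp_all add: lin complex_vector.scale_right_diff_distrib cinner_diff_right cinner_diag_op\<close>)
  then show "T = diag_op (\<lambda>i. f (l i))" by auto
qed (simp add: cinner_diag_op bounded_clinear_simps[OF diag_op_clinear])

end

section \<open>Schatten norms of multiples of finite-rank projections\<close>

lemma cadjoint_eqI:
  assumes S: "bounded_clinear S" "\<And>x y. cinner (S x) y = cinner x (T y)"
  shows "cadjoint T = S"
  unfolding cadjoint_def
proof (rule the_equality)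
  fix R assume R: "bounded_clinear R \<and> (\<forall>x y. cinner (R x) y = cinner x (T y))"
  show "R = S"
  proof
    fix x
    have "cinner (R x - S x) y = 0" for y
      using R S by (simp add: cinner_diff_left)
    from this[of "R x - S x"] show "R x = S x" using cinner_eq_zero_iff[of "R x - S x"] by simp
  qed
qed (use S in simp)

text \<open>Positive square roots of a multiple of a projection are unique.  On the kernel
  of \<open>Q\<close> it follows from \<open>\<parallel>R x\<parallel>\<^sup>2 = \<langle>x, R\<^sup>2 x\<rangle>\<close>.  On the range of \<open>Q\<close> we have
  \<open>(R + s) (R - s) = 0\<close>, while \<open>R + s\<close> is injective because \<open>R\<close> is positive and \<open>s > 0\<close>.\<close>

lemma positive_root_unique:
  assumes Q: "positive_op Q" "\<And>x. Q (Q x) = Q x"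
    and R: "positive_op R" "\<And>x. R (R x) = scaleC (complex_of_real (s\<^sup>2)) (Q x)" and s: "0 < s"
  shows "R x = scaleC (complex_of_real s) (Q x)"
proof -
  have linQ: "bounded_clinear Q" and linR: "bounded_clinear R"
    and symR: "\<And>x y. cinner (R x) y = cinner x (R y)"
    using Q R by (auto simp: positive_op_def bounded_self_adjoint_simps)
  note lin = bounded_clinear_simps[OF linQ] bounded_clinear_simps[OF linR]
  have ker: "R x = 0" if "Q x = 0" for x
  proof -
    have "cinner (R x) (R x) = 0"
      unfolding symR R(2) that by simp
    then show ?thesis by (simp add: cinner_eq_zero_iff)
  qed
  have ran: "R x = scaleC (complex_of_real s) x" if "Q x = x" for x
  proof -
    define y where "y = R x - scaleC (complex_of_real s) x"
    have Ry: "R y = - scaleC (complex_of_real s) y"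
      unfolding y_def using that
      by (simp add: lin R(2) complex_vector.scale_right_diff_distrib scaleC_scaleC power2_eq_square)
    have "cinner y (R y) = complex_of_real (- (s * (norm y)\<^sup>2))"
      unfolding Ry using cinner_diff_right[of y 0 "scaleC (complex_of_real s) y"]
      by (simp add: cinner_scaleC_right cinner_self)
    moreover have "0 \<le> Re (cinner y (R y))" using R(1) by (simp add: positive_op_def)
    ultimately have "s * (norm y)\<^sup>2 \<le> 0" by simp
    with s have "y = 0" by (simp add: mult_le_0_iff)
    then show ?thesis by (simp add: y_def)
  qed
  have "R x = R (Q x) + R (x - Q x)"
    by (simp add: lin)
  then show ?thesis
    using ran[of "Q x"] ker[of "x - Q x"] by (simp add: Q(2) lin)
qed

lemma positive_span_proj:
  assumes "orthonormal n u" "0 \<le> s"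
  shows "positive_op (\<lambda>x. scaleC (complex_of_real s) (span_proj n u x))"
  unfolding positive_op_def
proof (intro conjI allI)
  show "bounded_self_adjoint (\<lambda>x. scaleC (complex_of_real s) (span_proj n u x))"
    by (rule bounded_self_adjoint_scaleC[OF bounded_self_adjoint_span_proj])
  fix x
  have "cinner x (span_proj n u x) = cinner x (span_proj n u (span_proj n u x))"
    by (simp add: span_proj_idem[OF assms(1)])
  also have "\<dots> = complex_of_real ((norm (span_proj n u x))\<^sup>2)"
    by (simp only: bounded_self_adjoint_simps(2)[OF bounded_self_adjoint_span_proj, symmetric] cinner_self)
  finally show "0 \<le> Re (cinner x (scaleC (complex_of_real s) (span_proj n u x)))"
    using assms(2) by (simp add: cinner_scaleC_right)
qed

lemma abs_op_span_proj:
  assumes u: "orthonormal n u" and g: "g \<noteq> 0"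
  shows "abs_op (\<lambda>x. scaleC g (span_proj n u x)) = (\<lambda>x. scaleC (complex_of_real (cmod g)) (span_proj n u x))"
proof -
  let ?T = "\<lambda>x. scaleC g (span_proj n u x)"
  let ?P = "\<lambda>x. scaleC (complex_of_real (cmod g)) (span_proj n u x)"
  note sa = bounded_self_adjoint_simps[OF bounded_self_adjoint_span_proj[of n u]]
  note lin = bounded_clinear_simps[OF sa(1)]
  have adj: "cadjoint ?T = (\<lambda>x. scaleC (cnj g) (span_proj n u x))"
    by (rule cadjoint_eqI)
       (simp_all add: bounded_clinear_scaleC sa cinner_scaleC_left cinner_scaleC_right)
  have sq: "cadjoint ?T \<circ> ?T = (\<lambda>x. scaleC (complex_of_real ((cmod g)\<^sup>2)) (span_proj n u x))"
    unfolding adj complex_norm_square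
    by (rule ext) (simp add: lin span_proj_idem[OF u] scaleC_scaleC mult.commute)
  show ?thesis
    unfolding abs_op_def sq
  proof (rule the_equality)
    have "?P \<circ> ?P = (\<lambda>x. scaleC (complex_of_real ((cmod g)\<^sup>2)) (span_proj n u x))"
      by (rule ext) (simp add: lin span_proj_idem[OF u] scaleC_scaleC power2_eq_square)
    then show "positive_op ?P \<and> ?P \<circ> ?P = (\<lambda>x. scaleC (complex_of_real ((cmod g)\<^sup>2)) (span_proj n u x))"
      by (simp add: positive_span_proj[OF u])
  next
    fix R :: "'a \<Rightarrow> 'a"
    assume R: "positive_op R \<and> R \<circ> R = (\<lambda>x. scaleC (complex_of_real ((cmod g)\<^sup>2)) (span_proj n u x))"
    then have RR: "R (R x) = scaleC (complex_of_real ((cmod g)\<^sup>2)) (span_proj n u x)" for x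
      by (auto simp: fun_eq_iff)
    have "positive_op (span_proj n u)"
      using positive_span_proj[OF u, of 1] by (simp add: scaleC_one)
    then have "R x = ?P x" for x
      by (rule positive_root_unique[OF _ span_proj_idem[OF u] _ RR]) (use R g in simp_all)
    then show "R = ?P" ..
  qed
qed

text \<open>The only positive eigenvalue of the absolute value is \<open>\<bar>g\<bar>\<close>, with an \<open>n\<close>-dimensional eigenspace.
  A null sequence that attains no positive value but \<open>\<bar>g\<bar>\<close> and is non-increasing takes it on an
  initial segment, whose length is prescribed.\<close>

lemma singular_values_span_proj:
  assumes u: "orthonormal n u" and g: "g \<noteq> 0"
  shows "singular_values (\<lambda>x. scaleC g (span_proj n u x)) = (\<lambda>j. if j < n then cmod g else 0)"
proof -
  let ?a = "cmod g"
  let ?s = "\<lambda>j::nat. if j < n then cmod g else 0"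
  note lin = bounded_clinear_simps[OF bounded_self_adjoint_simps(1)[OF bounded_self_adjoint_span_proj[of n u]]]
  have a: "0 < ?a" using g by simp
  have dim: "complex_vector.dim {x. abs_op (\<lambda>x. scaleC g (span_proj n u x)) x = scaleR t x} =
      (if t = ?a then n else 0)" if t: "0 < t" for t
  proof (cases "t = ?a")
    case True
    have "{x. scaleC (complex_of_real ?a) (span_proj n u x) = scaleR t x} = {x. span_proj n u x = x}"
      unfolding scaleR_scaleC True using a by (auto simp: complex_vector.scale_left_imp_eq)
    also have "\<dots> = complex_vector.span (u ` {..<n})"
      by (simp add: span_proj_eq_iff[OF u])
    finally show ?thesis using True by (simp only: abs_op_span_proj[OF u g] orthonormal_dim[OF u] if_True refl)
  next
    case False
    have "x = 0" if x: "scaleC (complex_of_real ?a) (span_proj n u x) = scaleR t x" for x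
    proof -
      have "scaleC (complex_of_real ?a) (span_proj n u x) = scaleC (complex_of_real t) (span_proj n u x)"
        using arg_cong[OF x, of "span_proj n u"] by (simp add: lin scaleR_scaleC span_proj_idem[OF u])
      with False have "span_proj n u x = 0"
        using complex_vector.scale_right_imp_eq by (metis of_real_eq_iff)
      with x t show ?thesis by simp
    qed
    then have "{x. scaleC (complex_of_real ?a) (span_proj n u x) = scaleR t x} = {0}"
      by (auto simp: lin)
    moreover have "complex_vector.dim {0 :: 'a} = 0"
      by (rule complex_vector.dim_unique[of "{}"]) (auto simp: complex_vector.independent_empty)
    ultimately show ?thesis using False by (simp add: abs_op_span_proj[OF u g])
  qed
  show ?thesis
    unfolding singular_values_def
  proof (rule the_equality)
    have "antimono ?s" using a by (auto intro!: antimonoI)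
    moreover have "?s \<longlonglongrightarrow> 0"
      by (rule tendsto_eventually) (auto simp: eventually_sequentially intro: exI[of _ n])
    moreover have "card {j. ?s j = t} = (if t = ?a then n else 0)" if "0 < t" for t
    proof -
      have "{j. ?s j = t} = (if t = ?a then {..<n} else {})" using that by auto
      then show ?thesis by simp
    qed
    ultimately show "antimono ?s \<and> ?s \<longlonglongrightarrow> 0 \<and> (\<forall>t>0. card {j. ?s j = t} =
        complex_vector.dim {x. abs_op (\<lambda>x. scaleC g (span_proj n u x)) x = scaleR t x})"
      using dim by simp
  next
    fix s :: "nat \<Rightarrow> real"
    assume s: "antimono s \<and> s \<longlonglongrightarrow> 0 \<and> (\<forall>t>0. card {j. s j = t} =
        complex_vector.dim {x. abs_op (\<lambda>x. scaleC g (span_proj n u x)) x = scaleR t x})"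
    then have anti: "antimono s" and lim: "s \<longlonglongrightarrow> 0"
      and card: "\<And>t. 0 < t \<Longrightarrow> card {j. s j = t} = (if t = ?a then n else 0)"
      by (auto simp: dim)
    have nonneg: "0 \<le> s j" for j using decseq_ge[OF anti lim] .
    have fin: "finite {j. s j = t}" if t: "0 < t" for t
    proof -
      obtain N where "\<And>j. j \<ge> N \<Longrightarrow> s j < t"
        using order_tendstoD(2)[OF lim t] by (auto simp: eventually_sequentially)
      then have "{j. s j = t} \<subseteq> {..<N}" by (force simp: not_le[symmetric])
      then show ?thesis by (rule finite_subset) simp
    qed
    have val: "s j = ?a" if "0 < s j" for j
    proof -
      have "card {i. s i = s j} > 0" using fin[OF that] by (auto simp: card_gt_0_iff)
      then show ?thesis using card[OF that] by (auto split: if_splits)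
    qed
    define K where "K = {j. s j = ?a}"
    have "K \<subseteq> {..<n}"
    proof
      fix j assume j: "j \<in> K"
      have sub: "{..j} \<subseteq> K"
      proof
        fix i assume "i \<in> {..j}"
        then have "s j \<le> s i" using anti by (auto dest: antimonoD)
        with j a have "0 < s i" unfolding K_def mem_Collect_eq by linarith
        then show "i \<in> K" using val by (simp add: K_def)
      qed
      have "finite K" using fin[OF a] by (simp add: K_def)
      then have "card {..j} \<le> card K" using sub by (rule card_mono)
      then show "j \<in> {..<n}" using card[OF a] by (simp add: K_def)
    qed
    moreover have "card K = card {..<n}" using card[OF a] by (simp add: K_def)
    ultimately have K: "K = {..<n}" by (intro card_subset_eq) auto
    show "s = ?s"
    proof
      fix j
      show "s j = ?s j"
      proof (cases "j < n")
        case True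
        then have "j \<in> K" using K by simp
        with True show ?thesis by (simp add: K_def)
      next
        case False
        then have "j \<notin> K" using K by simp
        then have "\<not> 0 < s j" using val[of j] unfolding K_def by blast
        with False nonneg[of j] show ?thesis by simp
      qed
    qed
  qed
qed

text \<open>By the Cauchy--Schwarz inequality the coefficients of a vector of the unit ball are at most
  \<open>1\<close>, so the image lies in a finite sum of compact discs.\<close>

lemma compact_op_span_proj:
  assumes u: "orthonormal n u"
  shows "compact_op (\<lambda>x. scaleC g (span_proj n u x))"
  unfolding compact_op_def
proof
  show "bounded_clinear (\<lambda>x. scaleC g (span_proj n u x))"
    by (rule bounded_clinear_scaleC) (rule bounded_self_adjoint_simps(1)[OF bounded_self_adjoint_span_proj])
  have "\<exists>K. compact K \<and> (\<lambda>x. span_proj m u x) ` cball 0 1 \<subseteq> K" if "m \<le> n" for m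
    using that
  proof (induction m)
    case 0
    show ?case by (rule exI[of _ "{0}"]) (auto simp: span_proj_def)
  next
    case (Suc m)
    then obtain K where K: "compact K" "(\<lambda>x. span_proj m u x) ` cball 0 1 \<subseteq> K" by auto
    let ?L = "(\<lambda>c. scaleC c (u m)) ` cball 0 1"
    have "compact ?L"
      by (intro compact_continuous_image linear_continuous_on bounded_linear_scaleC_left compact_cball)
    with K(1) have "compact {x + y |x y. x \<in> K \<and> y \<in> ?L}"
      by (rule compact_sums)
    moreover have "span_proj (Suc m) u x \<in> {x + y |x y. x \<in> K \<and> y \<in> ?L}" if x: "x \<in> cball 0 1" for x
    proof -
      have "norm (u m) = 1"
        using u Suc.prems by (simp add: orthonormal_def norm_eq_sqrt_cinner)
      then have "cmod (cinner (u m) x) \<le> 1"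
        using norm_cinner_le[of "u m" x] x by simp
      moreover have "span_proj (Suc m) u x = span_proj m u x + scaleC (cinner (u m) x) (u m)"
        by (simp add: span_proj_def rank_one_proj_def)
      ultimately show ?thesis using K(2) x by fastforce
    qed
    ultimately show ?case by blast
  qed
  then obtain K where K: "compact K" "span_proj n u ` cball 0 1 \<subseteq> K" by blast
  let ?S = "(\<lambda>x. scaleC g (span_proj n u x)) ` cball 0 1"
  have gK: "compact (scaleC g ` K)"
    by (intro compact_continuous_image linear_continuous_on bounded_linear_scaleC K)
  moreover have "?S \<subseteq> scaleC g ` K"
    using K(2) by auto
  ultimately have "closure ?S \<subseteq> scaleC g ` K"
    by (intro closure_minimal compact_imp_closed)
  then have "closure ?S = scaleC g ` K \<inter> closure ?S" by auto
  then show "compact (closure ?S)"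
    using compact_Int_closed[OF gK closed_closure, of ?S] by simp
qed

lemma schatten_span_proj:
  assumes u: "orthonormal n u" and g: "g \<noteq> 0" and p: "0 < p"
  shows "(\<lambda>x. scaleC g (span_proj n u x)) \<in> schatten_class p"
    and "schatten_norm p UNIV (\<lambda>x. scaleC g (span_proj n u x)) = ennreal (real n powr (1 / p) * cmod g)"
proof -
  have "(\<lambda>j. if j \<in> {..<n} then cmod g powr p else 0) sums (\<Sum>j<n. cmod g powr p)"
    by (rule sums_If_finite_set) simp
  moreover have "(\<lambda>j. if j \<in> {..<n} then cmod g powr p else 0) =
      (\<lambda>j. singular_values (\<lambda>x. scaleC g (span_proj n u x)) j powr p)"
    by (auto simp: singular_values_span_proj[OF u g])
  ultimately have sums: "(\<lambda>j. singular_values (\<lambda>x. scaleC g (span_proj n u x)) j powr p) sums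
      (real n * cmod g powr p)"
    by simp
  then show mem: "(\<lambda>x. scaleC g (span_proj n u x)) \<in> schatten_class p"
    by (auto simp: schatten_class_def compact_op_span_proj[OF u] sums_iff)
  show "schatten_norm p UNIV (\<lambda>x. scaleC g (span_proj n u x)) = ennreal (real n powr (1 / p) * cmod g)"
    using mem sums p by (simp add: schatten_norm_def sums_iff powr_mult powr_powr)
qed

section \<open>Interlacing rank-one perturbations\<close>

text \<open>The numbers \<open>c\<^sub>j\<close> in the partial fraction decomposition
  \<open>\<Prod>(z - b\<^sub>i) / \<Prod>(z - a\<^sub>i) = 1 - \<Sum> c\<^sub>j / (z - a\<^sub>j)\<close>.\<close>

definition interlacing_weight :: "nat \<Rightarrow> (nat \<Rightarrow> real) \<Rightarrow> (nat \<Rightarrow> real) \<Rightarrow> nat \<Rightarrow> real" where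
  "interlacing_weight n a b j = (b j - a j) * (\<Prod>i\<in>{..<n} - {j}. (a j - b i) / (a j - a i))"

text \<open>Each factor of the product compares the positions of \<open>b\<^sub>i\<close> and \<open>a\<^sub>i\<close> relative to \<open>a\<^sub>j\<close>;
  by interlacing both lie on the same side.\<close>

lemma interlacing_weight_pos:
  assumes ab: "\<And>i. i < n \<Longrightarrow> a i < b i" and ba: "\<And>i j. i < j \<Longrightarrow> j < n \<Longrightarrow> b i < a j" and j: "j < n"
  shows "0 < interlacing_weight n a b j"
  unfolding interlacing_weight_def
proof (rule mult_pos_pos)
  show "0 < b j - a j" using ab[OF j] by simp
  show "0 < (\<Prod>i\<in>{..<n} - {j}. (a j - b i) / (a j - a i))"
  proof (rule prod_pos)
    fix i assume "i \<in> {..<n} - {j}"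
    then have i: "i < n" "i \<noteq> j" by auto
    show "0 < (a j - b i) / (a j - a i)"
    proof (cases "i < j")
      case True
      with ab[OF i(1)] ba[OF True j] show ?thesis by (intro divide_pos_pos) auto
    next
      case False
      with i have "j < i" by simp
      with ab[OF i(1)] ab[OF j] ba[OF this i(1)] show ?thesis by (intro divide_neg_neg) auto
    qed
  qed
qed

text \<open>The partial fraction decomposition at its zero \<open>z = b\<^sub>k\<close>.  Below, \<open>A - L\<close> is the numerator that
  the decomposition predicts; it is monic of degree \<open>n\<close>, like \<open>B\<close>, and agrees with \<open>B\<close> at the
  \<open>n\<close> points \<open>a\<^sub>j\<close>.\<close>

lemma interlacing_weight_sum:
  assumes inj: "inj_on a {..<n}" and k: "k < n" and bk: "\<And>j. j < n \<Longrightarrow> b k \<noteq> a j"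
  shows "(\<Sum>j<n. interlacing_weight n a b j / (b k - a j)) = 1"
proof -
  define A where "A = (\<Prod>i<n. [:- a i, 1:])"
  define B where "B = (\<Prod>i<n. [:- b i, 1:])"
  define N where "N j = (\<Prod>i\<in>{..<n} - {j}. [:- a i, 1:])" for j
  define L where "L = (\<Sum>j<n. smult (interlacing_weight n a b j) (N j))"
  have degA: "degree A = n" and degB: "degree B = n"
    unfolding A_def B_def by (simp_all add: degree_prod_sum_eq)
  have lead: "coeff A n = 1" "coeff B n = 1"
    using lead_coeff_prod[of "\<lambda>i. [:- a i, 1:]" "{..<n}"] lead_coeff_prod[of "\<lambda>i. [:- b i, 1:]" "{..<n}"]
    degA degB by (simp_all add: A_def B_def)
  have degN: "degree (N j) < n" if "j < n" for j
    unfolding N_def using that by (subst degree_prod_sum_eq) auto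
  have degL: "degree L < n"
    unfolding L_def using k degN by (intro degree_sum_less) (auto intro: le_less_trans[OF degree_smult_le])
  have "A - L = B"
  proof (rule poly_eqI_degree_lead_coeff[where A = "a ` {..<n}" and n = n])
    show "coeff (A - L) n = coeff B n"
      using degL by (simp add: lead coeff_eq_0)
    show "n \<le> card (a ` {..<n})" by (simp add: card_image[OF inj])
    show "degree (A - L) \<le> n" using degA degL by (intro degree_diff_le) auto
    show "degree B \<le> n" by (simp add: degB)
    fix z assume "z \<in> a ` {..<n}"
    then obtain j where j: "j < n" and z: "z = a j" by auto
    have Nj: "poly (N i) (a j) = (if i = j then (\<Prod>i\<in>{..<n} - {j}. a j - a i) else 0)" if "i < n" for i
      using j that by (auto simp: N_def poly_prod)
    have "poly L (a j) = (\<Sum>i<n. if i = j then interlacing_weight n a b j * (\<Prod>i\<in>{..<n} - {j}. a j - a i) else 0)"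
      unfolding L_def poly_sum by (rule sum.cong) (auto simp: Nj)
    also have "\<dots> = interlacing_weight n a b j * (\<Prod>i\<in>{..<n} - {j}. a j - a i)"
      using j by simp
    also have "\<dots> = (b j - a j) * (\<Prod>i\<in>{..<n} - {j}. a j - b i)"
    proof -
      have "(\<Prod>i\<in>{..<n} - {j}. a j - a i) \<noteq> 0"
        using inj j by (auto simp: inj_on_def)
      then show ?thesis by (simp add: interlacing_weight_def prod_dividef)
    qed
    also have "\<dots> = - (\<Prod>i<n. a j - b i)"
      using j by (subst prod.remove[of "{..<n}" j]) (auto simp: algebra_simps)
    finally have "poly L (a j) = - poly B (a j)" by (simp add: B_def poly_prod)
    moreover have "poly A (a j) = 0" using j by (auto simp: A_def poly_prod)
    ultimately show "poly (A - L) z = poly B z" by (simp add: z)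
  qed
  moreover have "poly B (b k) = 0" using k by (auto simp: B_def poly_prod)
  ultimately have eq: "poly L (b k) = poly A (b k)" by (metis poly_diff eq_iff_diff_eq_0)
  have A0: "poly A (b k) \<noteq> 0" using bk by (simp add: A_def poly_prod)
  have "poly L (b k) = (\<Sum>j<n. poly A (b k) * (interlacing_weight n a b j / (b k - a j)))"
    unfolding L_def poly_sum
  proof (rule sum.cong)
    fix j assume "j \<in> {..<n}"
    then have "poly A (b k) = (b k - a j) * poly (N j) (b k)" and "b k - a j \<noteq> 0"
      using bk[of j] by (simp_all add: A_def N_def poly_prod prod.remove[of "{..<n}" j] left_diff_distrib)
    then show "poly (smult (interlacing_weight n a b j) (N j)) (b k) =
        poly A (b k) * (interlacing_weight n a b j / (b k - a j))"
      by simp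
  qed simp
  with eq have "poly A (b k) * (\<Sum>j<n. interlacing_weight n a b j / (b k - a j)) = poly A (b k)"
    by (simp add: sum_distrib_left)
  with A0 show ?thesis by simp
qed

text \<open>Take \<open>v = \<Sum> \<surd>c\<^sub>j e\<^sub>j\<close> with the weights above.  A vector \<open>z\<close> is an eigenvector of the perturbed
  operator for the eigenvalue \<open>b\<^sub>k\<close> as soon as \<open>(a - b\<^sub>k) z = v\<close> and \<open>\<langle>v, z\<rangle> = -1\<close>, where \<open>a\<close> is the
  diagonal operator; the first equation determines \<open>z\<close>, and the second is then the identity
  \<open>\<Sum> c\<^sub>j / (b\<^sub>k - a\<^sub>j) = 1\<close>.  The same identity for the largest \<open>b\<^sub>k\<close>, all of whose terms are positive
  with denominators at most \<open>b\<^sub>k - a\<^sub>0\<close>, bounds \<open>\<parallel>v\<parallel>\<^sup>2 = \<Sum> c\<^sub>j\<close>.\<close>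

lemma rank_one_interlacing:
  fixes e :: "nat \<Rightarrow> 'a::complex_hilbert"
  assumes e: "orthonormal n e" and n: "0 < n"
    and ab: "\<And>i. i < n \<Longrightarrow> a i < b i" and ba: "\<And>i j. i < j \<Longrightarrow> j < n \<Longrightarrow> b i < a j"
  obtains w v where "orthonormal n w" "\<And>x. span_proj n w x = span_proj n e x"
    "v \<noteq> 0" "(norm v)\<^sup>2 \<le> b (n - 1) - a 0"
    "\<And>x. (\<Sum>i<n. scaleC (complex_of_real (b i)) (rank_one_proj (w i) x)) =
      (\<Sum>i<n. scaleC (complex_of_real (a i)) (rank_one_proj (e i) x)) + rank_one_proj v x"
proof -
  have amono: "a i < a j" if "i < j" "j < n" for i j
    using ab[of i] ba[OF that] that by simp
  have a_ne: "a i \<noteq> a j" if "i < n" "j < n" "i \<noteq> j" for i j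
    using amono[of i j] amono[of j i] that by (cases "i < j") auto
  have inj: "inj_on a {..<n}" using a_ne by (auto simp: inj_on_def)
  have ne: "b k \<noteq> a j" if "k < n" "j < n" for j k
    using ba[of k j] ab[of j] ab[of k] amono[of j k] that by (cases k j rule: linorder_cases) auto
  have b_ne: "b k \<noteq> b l" if "k < n" "l < n" "k \<noteq> l" for k l
    using ba[of k l] ba[of l k] ab[of k] ab[of l] that by (cases "k < l") auto
  define c where "c = interlacing_weight n a b"
  have c: "0 < c j" if "j < n" for j
    unfolding c_def using ab ba that by (rule interlacing_weight_pos)
  have csum: "(\<Sum>j<n. c j / (a j - b k)) = -1" if "k < n" for k
  proof -
    have "(\<Sum>j<n. c j / (a j - b k)) = - (\<Sum>j<n. c j / (b k - a j))"
      unfolding sum_negf[symmetric] by (rule sum.cong) (simp_all flip: divide_minus_right)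
    with interlacing_weight_sum[of a n k b, OF inj that ne[OF that]] show ?thesis by (simp add: c_def)
  qed
  have coeff_cinner: "cinner (\<Sum>j<n. scaleC (complex_of_real (f j)) (e j)) (\<Sum>j<n. scaleC (complex_of_real (g j)) (e j)) =
      complex_of_real (\<Sum>j<n. f j * g j)" for f g
    unfolding cinner_sum_left cinner_scaleC_left of_real_sum
    by (rule sum.cong) (simp_all add: cinner_orthonormal_sum[OF e])
  define v where "v = (\<Sum>j<n. scaleC (complex_of_real (sqrt (c j))) (e j))"
  define z where "z k = (\<Sum>j<n. scaleC (complex_of_real (sqrt (c j) / (a j - b k))) (e j))" for k
  have vz: "cinner v (z k) = -1" if "k < n" for k
  proof -
    have "(\<Sum>j<n. sqrt (c j) * (sqrt (c j) / (a j - b k))) = (\<Sum>j<n. c j / (a j - b k))"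
      by (rule sum.cong) (use c in \<open>simp_all add: less_imp_le\<close>)
    with csum[OF that] show ?thesis by (simp only: v_def z_def coeff_cinner) simp
  qed
  have zz: "cinner (z k) (z l) = 0" if kl: "k < n" "l < n" "k \<noteq> l" for k l
  proof -
    \<comment> \<open>by \<open>1 / ((a\<^sub>j - b\<^sub>k) (a\<^sub>j - b\<^sub>l)) = (1 / (a\<^sub>j - b\<^sub>k) - 1 / (a\<^sub>j - b\<^sub>l)) / (b\<^sub>k - b\<^sub>l)\<close>\<close>
    have "(\<Sum>j<n. (sqrt (c j) / (a j - b k)) * (sqrt (c j) / (a j - b l))) =
        (\<Sum>j<n. (c j / (a j - b k) - c j / (a j - b l)) / (b k - b l))"
    proof (rule sum.cong)
      fix j assume "j \<in> {..<n}"
      then have "0 < c j" "a j - b k \<noteq> 0" "a j - b l \<noteq> 0" "b k - b l \<noteq> 0"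
        using c[of j] ne[of k j] ne[of l j] b_ne[OF kl] kl by auto
      moreover from this have "sqrt (c j) * sqrt (c j) = c j" by simp
      ultimately show "(sqrt (c j) / (a j - b k)) * (sqrt (c j) / (a j - b l)) =
          (c j / (a j - b k) - c j / (a j - b l)) / (b k - b l)"
        by (simp add: divide_simps) (simp add: algebra_simps)
    qed simp
    also have "\<dots> = 0"
      using csum[OF kl(1)] csum[OF kl(2)] by (simp flip: sum_divide_distrib add: sum_subtractf)
    finally show ?thesis by (simp only: z_def coeff_cinner) simp
  qed
  have z0: "z k \<noteq> 0" if "k < n" for k using vz[OF that] by auto
  define w where "w k = scaleC (complex_of_real (1 / norm (z k))) (z k)" for k
  have w: "orthonormal n w"
    unfolding orthonormal_def
  proof (intro allI impI)
    fix k l assume kl: "k < n" "l < n"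
    show "cinner (w k) (w l) = (if k = l then 1 else 0)"
    proof (cases "k = l")
      case True
      have "norm (w k) = 1" using z0[OF kl(1)] by (simp add: w_def norm_scaleC norm_divide)
      with True show ?thesis by (simp add: cinner_self)
    next
      case False
      with zz[OF kl] show ?thesis by (simp add: w_def cinner_scaleC_left cinner_scaleC_right)
    qed
  qed
  have proj: "span_proj n w x = span_proj n e x" for x
    by (rule span_proj_eqI[OF e w])
       (auto simp: w_def z_def intro!: complex_vector.span_scale complex_vector.span_sum
         intro: complex_vector.span_base)
  define D where "D x = (\<Sum>i<n. scaleC (complex_of_real (a i)) (rank_one_proj (e i) x)) + rank_one_proj v x" for x
  have clin: "bounded_clinear (rank_one_proj y)" for y :: 'a
    by (rule bounded_self_adjoint_simps(1)[OF bounded_self_adjoint_rank_one_proj])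
  have Dlin: "bounded_clinear D"
    unfolding D_def[abs_def]
    by (intro bounded_clinear_add bounded_clinear_sum bounded_clinear_scaleC clin)
  note Dsimps = bounded_clinear_simps[OF Dlin]
  have Dz: "D (z k) = scaleC (complex_of_real (b k)) (z k)" if k: "k < n" for k
  proof -
    have "D (z k) = (\<Sum>j<n. scaleC (complex_of_real (a j * (sqrt (c j) / (a j - b k)))) (e j)) - v"
      unfolding D_def
      by (simp add: rank_one_proj_def vz[OF k])
         (rule sum.cong, simp_all add: z_def cinner_orthonormal_sum[OF e] scaleC_scaleC)
    also have "\<dots> = (\<Sum>j<n. scaleC (complex_of_real (b k * (sqrt (c j) / (a j - b k)))) (e j))"
      unfolding v_def sum_subtractf[symmetric] complex_vector.scale_left_diff_distrib[symmetric]
        of_real_diff[symmetric]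
    proof (rule sum.cong)
      fix j assume "j \<in> {..<n}"
      then have "a j - b k \<noteq> 0" using ne[OF k, of j] by auto
      then have "a j * (sqrt (c j) / (a j - b k)) - sqrt (c j) = b k * (sqrt (c j) / (a j - b k))"
        by (simp add: field_simps)
      then show "scaleC (complex_of_real (a j * (sqrt (c j) / (a j - b k)) - sqrt (c j))) (e j) =
          scaleC (complex_of_real (b k * (sqrt (c j) / (a j - b k)))) (e j)" by (simp only:)
    qed simp
    also have "\<dots> = scaleC (complex_of_real (b k)) (z k)"
      by (simp add: z_def complex_vector.scale_sum_right scaleC_scaleC)
    finally show ?thesis .
  qed
  have Dw: "D (w k) = scaleC (complex_of_real (b k)) (w k)" if k: "k < n" for k
    unfolding w_def Dsimps Dz[OF k] scaleC_scaleC by (simp add: mult.commute)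
  have eperp: "cinner (e i) (x - span_proj n e x) = 0" if "i < n" for i x
    using cinner_span_proj[OF e that] by (simp add: cinner_diff_right)
  have Dperp: "D (x - span_proj n e x) = 0" for x
  proof -
    have "cinner v (x - span_proj n e x) = 0"
      unfolding v_def cinner_sum_left by (rule sum.neutral) (simp add: cinner_scaleC_left eperp)
    moreover have "(\<Sum>i<n. scaleC (complex_of_real (a i)) (rank_one_proj (e i) (x - span_proj n e x))) = 0"
      by (rule sum.neutral) (simp add: rank_one_proj_def eperp)
    ultimately show ?thesis by (simp add: D_def rank_one_proj_def)
  qed
  \<comment> \<open>both sides agree on each \<open>w\<^sub>k\<close> and vanish on the complement of their span\<close>
  have main: "(\<Sum>i<n. scaleC (complex_of_real (b i)) (rank_one_proj (w i) x)) = D x" for x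
  proof -
    have "D x = D (span_proj n w x)"
      using Dperp[of x] by (simp add: Dsimps proj)
    also have "\<dots> = (\<Sum>i<n. scaleC (cinner (w i) x) (D (w i)))"
      by (simp add: span_proj_def rank_one_proj_def Dsimps)
    also have "\<dots> = (\<Sum>i<n. scaleC (complex_of_real (b i)) (rank_one_proj (w i) x))"
      by (rule sum.cong) (simp_all add: Dw rank_one_proj_def scaleC_scaleC mult.commute)
    finally show ?thesis by simp
  qed
  have vv: "(norm v)\<^sup>2 = (\<Sum>j<n. c j)"
  proof -
    have "complex_of_real ((norm v)\<^sup>2) = complex_of_real (\<Sum>j<n. sqrt (c j) * sqrt (c j))"
      unfolding cinner_self[symmetric] v_def by (rule coeff_cinner)
    then have "(norm v)\<^sup>2 = (\<Sum>j<n. sqrt (c j) * sqrt (c j))" by (simp only: of_real_eq_iff)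
    also have "\<dots> = (\<Sum>j<n. c j)" by (rule sum.cong) (use c in \<open>simp_all add: less_imp_le\<close>)
    finally show ?thesis .
  qed
  let ?m = "n - 1"
  have m: "?m < n" using n by simp
  have "(\<Sum>j<n. c j) \<le> (\<Sum>j<n. (b ?m - a 0) * (c j / (b ?m - a j)))"
  proof (rule sum_mono)
    fix j assume "j \<in> {..<n}"
    then have j: "j < n" by simp
    have "a 0 \<le> a j" using amono[of 0 j] j by (cases "j = 0") auto
    moreover have "a j < b ?m"
    proof -
      have "j < ?m \<or> j = ?m" using j by linarith
      then show ?thesis using ab[OF m] amono[of j ?m] m by (auto intro: less_trans)
    qed
    ultimately have "1 \<le> (b ?m - a 0) / (b ?m - a j)" by simp
    then have "c j * 1 \<le> c j * ((b ?m - a 0) / (b ?m - a j))"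
      using c[OF j] by (intro mult_left_mono) auto
    then show "c j \<le> (b ?m - a 0) * (c j / (b ?m - a j))" by (simp add: mult.commute)
  qed
  also have "\<dots> = b ?m - a 0"
    using interlacing_weight_sum[of a n ?m b, OF inj m ne[OF m]] by (simp only: sum_distrib_left[symmetric] c_def) simp
  finally have "(norm v)\<^sup>2 \<le> b ?m - a 0" by (simp add: vv)
  moreover have "v \<noteq> 0" using vz[OF m] by auto
  ultimately show ?thesis using that[OF w proj] main by (simp add: D_def)
qed

section \<open>Periodic functions\<close>

text \<open>The index \<open>n\<close> carries the projection onto the orthogonal complement of the family.\<close>

definition ortho_resolution :: "nat \<Rightarrow> (nat \<Rightarrow> 'a::complex_hilbert) \<Rightarrow> nat \<Rightarrow> 'a \<Rightarrow> 'a" where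
  "ortho_resolution n u i x = (if i < n then rank_one_proj (u i) x else x - span_proj n u x)"

lemma finite_resolution_ortho:
  assumes u: "orthonormal n u"
  shows "finite_resolution {..n} (ortho_resolution n u)"
proof
  note sa = bounded_self_adjoint_simps[OF bounded_self_adjoint_span_proj[of n u]]
  note lin = bounded_clinear_simps[OF sa(1)]
  show "finite {..n}" by simp
  fix i assume i: "i \<in> {..n}"
  show "bounded_self_adjoint (ortho_resolution n u i)"
  proof (cases "i < n")
    case True
    then show ?thesis
      by (simp add: ortho_resolution_def[abs_def] bounded_self_adjoint_rank_one_proj)
  next
    case False
    have "bounded_self_adjoint (\<lambda>x. x + scaleC (complex_of_real (-1)) (span_proj n u x))"
      by (intro bounded_self_adjoint_add bounded_self_adjoint_id bounded_self_adjoint_scaleC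
          bounded_self_adjoint_span_proj)
    with False show ?thesis by (simp add: ortho_resolution_def[abs_def] scaleC_one)
  qed
  fix j x assume j: "j \<in> {..n}"
  have uu: "rank_one_proj (u i) (rank_one_proj (u j) x) = (if i = j then rank_one_proj (u i) x else 0)"
    if "i < n" "j < n"
    using u that by (simp add: orthonormal_def rank_one_proj_def cinner_scaleC_right)
  have uc: "rank_one_proj (u i) (x - span_proj n u x) = 0" if "i < n"
    using cinner_span_proj[OF u that] by (simp add: rank_one_proj_def cinner_diff_right)
  have cu: "rank_one_proj (u j) x - span_proj n u (rank_one_proj (u j) x) = 0" if "j < n"
    using span_proj_basis[OF u that] by (simp add: rank_one_proj_def lin)
  have cc: "x - span_proj n u x - span_proj n u (x - span_proj n u x) = x - span_proj n u x"
    by (simp add: lin span_proj_idem[OF u])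
  show "ortho_resolution n u i (ortho_resolution n u j x) =
      (if i = j then ortho_resolution n u i x else 0)"
    using i j uu uc cu cc by (auto simp: ortho_resolution_def)
next
  show "(\<Sum>i\<in>{..n}. ortho_resolution n u i x) = x" for x
    unfolding lessThan_Suc_atMost[symmetric]
    by (simp add: ortho_resolution_def span_proj_def)
qed

lemma schatten_rank_one_proj:
  assumes v: "v \<noteq> 0" and p: "0 < p"
  shows "rank_one_proj v \<in> schatten_class p"
    and "schatten_norm p UNIV (rank_one_proj v) = ennreal ((norm v)\<^sup>2)"
proof -
  define u where "u = scaleC (complex_of_real (1 / norm v)) v"
  have "norm u = 1" using v by (simp add: u_def norm_scaleC norm_divide)
  then have u: "orthonormal 1 (\<lambda>_. u)" by (simp add: orthonormal_def cinner_self)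
  have eq: "rank_one_proj v = (\<lambda>x. scaleC (complex_of_real ((norm v)\<^sup>2)) (span_proj 1 (\<lambda>_. u) x))"
  proof
    fix x
    have "complex_of_real ((norm v)\<^sup>2) * (cinner u x * complex_of_real (1 / norm v)) = cinner v x"
      using v by (simp add: u_def cinner_scaleC_left power2_eq_square)
    then show "rank_one_proj v x = scaleC (complex_of_real ((norm v)\<^sup>2)) (span_proj 1 (\<lambda>_. u) x)"
      unfolding span_proj_def rank_one_proj_def
      by (subst (2) u_def) (simp add: scaleC_scaleC)
  qed
  have g: "complex_of_real ((norm v)\<^sup>2) \<noteq> 0" using v by simp
  show "rank_one_proj v \<in> schatten_class p"
    unfolding eq by (rule schatten_span_proj(1)[OF u g p])
  show "schatten_norm p UNIV (rank_one_proj v) = ennreal ((norm v)\<^sup>2)"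
    unfolding eq schatten_span_proj(2)[OF u g p] by (simp add: norm_power)
qed

lemma periodic_multiple:
  fixes f :: "real \<Rightarrow> 'b"
  assumes "\<And>t. f (t + T) = f t"
  shows "f (t + real k * T) = f t"
proof (induction k)
  case (Suc k)
  then show ?case using assms[of "t + real k * T"] by (simp add: algebra_simps)
qed simp

text \<open>On a subspace of dimension \<open>n\<close>, let \<open>B\<close> and \<open>A\<close> have the interlacing eigenvalues \<open>a + j T\<close> and
  \<open>b + j T\<close>; \<open>f\<close> is constant on each of the two sets.  Both act as the scalar \<open>a\<close> on the complement, so the
  complement contributes neither to \<open>A - B\<close> nor to \<open>f(A) - f(B)\<close>.\<close>

lemma rank_one_shift_of_periodic:
  fixes f :: "real \<Rightarrow> complex"
  assumes inf: "infinite_dimensional TYPE('a::complex_hilbert)"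
    and f: "f \<in> borel_measurable borel" and per: "\<And>t. f (t + T) = f t"
    and ab: "a < b" "b < a + T" and fab: "f a \<noteq> f b" and n: "0 < n" and p: "0 < p"
  obtains A B :: "'a::complex_hilbert \<Rightarrow> 'a" where "bounded_self_adjoint A" "bounded_self_adjoint B"
    "(\<lambda>x. A x - B x) \<in> schatten_class p"
    "schatten_norm p UNIV (\<lambda>x. A x - B x) \<le> ennreal (real n * T)"
    "schatten_norm p (borel_calculus_dom f A \<inter> borel_calculus_dom f B)
       (\<lambda>x. borel_calculus f A x - borel_calculus f B x) = ennreal (real n powr (1 / p) * cmod (f b - f a))"
proof -
  have per': "f (t + real k * T) = f t" for t k
    using per by (rule periodic_multiple)
  have T: "0 < T" using ab by simp
  obtain e :: "nat \<Rightarrow> 'a" where e: "orthonormal n e" using orthonormal_exists[OF inf] by blast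
  have inter: "b + real i * T < a + real j * T" if "i < j" for i j :: nat
  proof -
    have "real i + 1 \<le> real j" using that by simp
    then have "(real i + 1) * T \<le> real j * T" using T by (intro mult_right_mono) auto
    with ab show ?thesis by (simp add: algebra_simps)
  qed
  obtain w v where w: "orthonormal n w" and proj: "\<And>x. span_proj n w x = span_proj n e x"
    and v: "v \<noteq> 0" and vnorm: "(norm v)\<^sup>2 \<le> (b + real (n - 1) * T) - (a + real 0 * T)"
    and pert: "\<And>x. (\<Sum>i<n. scaleC (complex_of_real (b + real i * T)) (rank_one_proj (w i) x)) =
      (\<Sum>i<n. scaleC (complex_of_real (a + real i * T)) (rank_one_proj (e i) x)) + rank_one_proj v x"
    by (rule rank_one_interlacing[where a = "\<lambda>i. a + real i * T" and b = "\<lambda>i. b + real i * T", OF e n])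
       (use ab inter in simp_all)
  interpret A: finite_resolution "{..n}" "ortho_resolution n w" by (rule finite_resolution_ortho[OF w])
  interpret B: finite_resolution "{..n}" "ortho_resolution n e" by (rule finite_resolution_ortho[OF e])
  define l where "l c i = (if i < n then c + real i * T else a)" for c :: real and i
  define A where "A = A.diag_op (\<lambda>i. complex_of_real (l b i))"
  define B where "B = B.diag_op (\<lambda>i. complex_of_real (l a i))"
  have Ax: "A.diag_op c x = (\<Sum>i<n. scaleC (c i) (rank_one_proj (w i) x)) + scaleC (c n) (x - span_proj n w x)" for c x
    unfolding A.diag_op_def by (simp add: ortho_resolution_def flip: lessThan_Suc_atMost)
  have Bx: "B.diag_op c x = (\<Sum>i<n. scaleC (c i) (rank_one_proj (e i) x)) + scaleC (c n) (x - span_proj n e x)" for c x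
    unfolding B.diag_op_def by (simp add: ortho_resolution_def flip: lessThan_Suc_atMost)
  have diff: "(\<lambda>x. A x - B x) = rank_one_proj v"
    using pert by (simp add: A_def B_def Ax Bx l_def proj fun_eq_iff)
  have fl: "f (l c i) = (if i < n then f c else f a)" for c i
    by (simp add: l_def per')
  have fA: "borel_calculus f A x = scaleC (f b) (span_proj n e x) + scaleC (f a) (x - span_proj n e x)" for x
    unfolding A_def A.borel_calculus_diag_op[OF f] Ax
    by (simp add: fl proj[symmetric]) (simp add: span_proj_def complex_vector.scale_sum_right)
  have fB: "borel_calculus f B x = scaleC (f a) (span_proj n e x) + scaleC (f a) (x - span_proj n e x)" for x
    unfolding B_def B.borel_calculus_diag_op[OF f] Bx
    by (simp add: fl) (simp add: span_proj_def complex_vector.scale_sum_right)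
  have fdiff: "(\<lambda>x. borel_calculus f A x - borel_calculus f B x) = (\<lambda>x. scaleC (f b - f a) (span_proj n e x))"
    by (simp add: fA fB complex_vector.scale_left_diff_distrib)
  have dom: "borel_calculus_dom f A \<inter> borel_calculus_dom f B = UNIV"
    unfolding A_def B_def A.borel_calculus_dom_diag_op[OF f] B.borel_calculus_dom_diag_op[OF f] by simp
  show thesis
  proof
    show "bounded_self_adjoint A" "bounded_self_adjoint B"
      unfolding A_def B_def by (fact A.diag_op_self_adjoint B.diag_op_self_adjoint)+
    show "(\<lambda>x. A x - B x) \<in> schatten_class p"
      unfolding diff by (rule schatten_rank_one_proj[OF v p])
    have "real (n - 1) * T = real n * T - T" using n by (simp add: of_nat_diff algebra_simps)
    with vnorm ab show "schatten_norm p UNIV (\<lambda>x. A x - B x) \<le> ennreal (real n * T)"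
      unfolding diff schatten_rank_one_proj(2)[OF v p] by (intro ennreal_leI) simp
    show "schatten_norm p (borel_calculus_dom f A \<inter> borel_calculus_dom f B)
       (\<lambda>x. borel_calculus f A x - borel_calculus f B x) = ennreal (real n powr (1 / p) * cmod (f b - f a))"
      unfolding dom fdiff using fab by (intro schatten_span_proj(2)[OF e _ p]) simp
  qed
qed

text \<open>If \<open>f\<close> takes different values at \<open>s\<close> and \<open>t\<close>, translate \<open>t\<close> by a multiple of the period into
  \<open>[s, s + T)\<close>; it cannot land on \<open>s\<close>.\<close>

lemma periodic_two_values:
  fixes f :: "real \<Rightarrow> complex"
  assumes T: "0 < T" and per: "\<And>t. f (t + T) = f t" and nonconst: "\<not> (\<exists>c. \<forall>t. f t = c)"
  obtains a b where "a < b" "b < a + T" "f a \<noteq> f b"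
proof -
  have pern: "f (t + real k * T) = f t" for t k
    using per by (rule periodic_multiple)
  have peri: "f (t - of_int k * T) = f t" for t k
  proof (cases k)
    case (nonneg m)
    then show ?thesis using pern[of "t - real m * T" m] by simp
  next
    case (neg m)
    then have k: "real_of_int k = - real (Suc m)" by simp
    show ?thesis using pern[of t "Suc m"] unfolding k by (simp only: mult_minus_left diff_minus_eq_add)
  qed
  obtain s t where st: "f t \<noteq> f s" using nonconst by blast
  define b where "b = t - of_int \<lfloor>(t - s) / T\<rfloor> * T"
  have "f b \<noteq> f s" using st by (simp add: b_def peri)
  moreover have "s \<le> b" "b < s + T"
  proof -
    define m where "m = real_of_int \<lfloor>(t - s) / T\<rfloor>"
    have "m \<le> (t - s) / T" "(t - s) / T < m + 1"
      unfolding m_def by linarith+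
    then have "m * T \<le> t - s" "t - s < (m + 1) * T" using T by (simp_all add: field_simps)
    then show "s \<le> b" "b < s + T" by (simp_all add: b_def m_def[symmetric] algebra_simps)
  qed
  ultimately show thesis using that[of s b] by (cases "s = b") auto
qed

theorem theorem1p0p1:
  fixes f :: "real \<Rightarrow> complex" and period :: real
  assumes "separable_space (euclidean :: 'a::complex_hilbert topology)"
    and "infinite_dimensional TYPE('a)"
    and "f \<in> borel_measurable borel"
    and "period > 0" and "\<And>t. f (t + period) = f t"
    and "\<not> (\<exists>c. \<forall>t. f t = c)"
  shows "\<forall>p. 0 < p \<and> p < 1 \<longrightarrow> \<not> schatten_operator_lipschitz TYPE('a) p f"
proof (intro allI impI notI)
  fix p :: real
  assume p: "0 < p \<and> p < 1" and lip: "schatten_operator_lipschitz TYPE('a) p f"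
  obtain a b where ab: "a < b" "b < a + period" and fab: "f a \<noteq> f b"
    by (rule periodic_two_values[of period f, OF assms(4,5,6)])
  define d where "d = cmod (f b - f a)"
  have d: "0 < d" using fab by (simp add: d_def)
  from lip obtain C where C: "0 < C" and le: "\<And>A B :: 'a \<Rightarrow> 'a. bounded_self_adjoint A \<Longrightarrow>
      bounded_self_adjoint B \<Longrightarrow> (\<lambda>x. A x - B x) \<in> schatten_class p \<Longrightarrow>
      schatten_norm p (borel_calculus_dom f A \<inter> borel_calculus_dom f B)
        (\<lambda>x. borel_calculus f A x - borel_calculus f B x)
      \<le> ennreal C * schatten_norm p UNIV (\<lambda>x. A x - B x)"
    unfolding schatten_operator_lipschitz_def by blast
  have bound: "real n powr (1 / p) * d \<le> C * (real n * period)" if n: "0 < n" for n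
  proof -
    obtain A B :: "'a \<Rightarrow> 'a" where AB: "bounded_self_adjoint A" "bounded_self_adjoint B"
      "(\<lambda>x. A x - B x) \<in> schatten_class p"
      and small: "schatten_norm p UNIV (\<lambda>x. A x - B x) \<le> ennreal (real n * period)"
      and large: "schatten_norm p (borel_calculus_dom f A \<inter> borel_calculus_dom f B)
       (\<lambda>x. borel_calculus f A x - borel_calculus f B x) = ennreal (real n powr (1 / p) * d)"
      unfolding d_def by (rule rank_one_shift_of_periodic[OF assms(2,3,5) ab fab n conjunct1[OF p]])
    have "ennreal (real n powr (1 / p) * d) \<le> ennreal C * ennreal (real n * period)"
      using le[OF AB] mult_left_mono[OF small, of "ennreal C"] unfolding large by simp
    also have "\<dots> = ennreal (C * (real n * period))"
      using C assms(4) by (simp add: ennreal_mult)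
    finally show ?thesis using C assms(4) by (simp add: ennreal_le_iff)
  qed
  define q where "q = 1 / p - 1"
  have q: "0 < q" using p by (simp add: q_def)
  define M where "M = C * period / d"
  have M: "0 < M" using C d assms(4) by (simp add: M_def)
  \<comment> \<open>\<open>n\<close> is chosen so large that \<open>n\<^sup>1\<^sup>/\<^sup>p = n n\<^sup>q\<close> exceeds \<open>n M\<close>\<close>
  obtain n :: nat where n: "M powr (1 / q) < real n" using reals_Archimedean2 by blast
  moreover have "0 < M powr (1 / q)" using M by simp
  ultimately have n0: "0 < real n" by linarith
  have "M = (M powr (1 / q)) powr q" using M q by (simp add: powr_powr)
  also have "\<dots> < real n powr q" using n q by (intro powr_less_mono2) auto
  finally have "M * d < real n powr q * d" using d by simp
  then have "C * period * real n < real n powr q * d * real n" using d n0 by (simp add: M_def)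
  also have "\<dots> = real n powr (q + 1) * d" using n0 by (simp add: powr_add)
  also have "\<dots> = real n powr (1 / p) * d" by (simp add: q_def)
  also have "\<dots> \<le> C * (real n * period)" using n0 by (intro bound) simp
  finally show False by (simp add: mult_ac)
qed

end
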